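(* Let $\mathbb{F}$ be a field of characteristic different from $2$, let $G\leq\mathrm{GL}_n(\mathbb{F})$ be a reflection group acting on $V=\mathbb{F}^n$, and let $\chi:G\to\mathbb{F}^\times$ be a linear character. Suppose $\omega_1,\dots,\omega_n$ are $\chi$-invariant $1$-forms with $$\omega_1\wedge\cdots\wedge\omega_n=c\,Q(\tilde{\mathcal A}_\chi)\,Q_\chi^{\,n-1}\,Q_{\chi\cdot\det}\,dz_1\wedge\cdots\wedge dz_n$$ for some $c\in\mathbb{F}^\times$. Then $\omega_1,\dots,\omega_n$ is a basis of the module $(\Omega^1)^G_\chi$ of $\chi$-invariant $1$-forms as a free module over $\mathbb{F}[V]^G$: $(\Omega^1)^G_\chi=\bigoplus_i\mathbb{F}[V]^G\,\omega_i$.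
   Context: $\mathbb{F}[V]=S(V^* )$; $z_1,\dots,z_n$ is a basis of $V^*$; $\Omega^1=\mathbb{F}[V]\otimes V^*$, with $G$ acting on $V^*$ by $(gf)(v)=f(g^{-1}v)$ and diagonally on forms. $(\Omega^1)^G_\chi=\{\omega\in\Omega^1: g\omega=\chi(g)\omega\ \forall g\in G\}$. A reflection is a finite-order element of $\mathrm{GL}(V)$ whose fixed space is a hyperplane; a reflection group is a finite group generated by reflections. For a hyperplane $H$ with defining linear form $l_H$, a reflection $s$ about $H$ satisfies $s(v)=v+l_H(v)\alpha_s$ (root vector $\alpha_s$); it is a transvection if $\alpha_s\in H$, diagonalizable otherwise. $\mathcal A$ is the set of reflecting hyperplanes of reflections in $G$. For $H\in\mathcal A$: $G_H$ is the pointwise stabilizer of $H$ in $G$, $K_H=\ker(\det|_{G_H})$, $e_H=|G_H:K_H|$, $G_H$ is generated by $K_H$ and a diagonalizable reflection $s_H$ of order $e_H$ ($s_H=1$ if $e_H=1$), and $b_H$ is the dimension of the span of the root vectors of transvections in $G_H$. For a linear character $\psi$ of $G$, $Q_\psi=\prod_{H\in\mathcal A}l_H^{a_H(\psi)}$, where $a_H(\psi)$ is the smallest nonnegative integer with $\psi(s_H)=\det(s_H)^{-a_H(\psi)}$. Finally $Q(\tilde{\mathcal A}_\chi)=\prod_{H\in\mathcal A,\ \chi(s_H)=1}l_H^{e_Hb_H}$. *)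

theory Defs
  imports "HOL-Analysis.Analysis" "HOL-Library.Poly_Mapping"
begin

text \<open>V = F^n is modelled as 'a^'n for a finite index type 'n (n = CARD('n)).
  A polynomial in z_1..z_n is a finitely supported map from monomials
  (finitely supported exponent vectors) to coefficients.\<close>

type_synonym ('a, 'n) mpoly = "('n \<Rightarrow>\<^sub>0 nat) \<Rightarrow>\<^sub>0 'a"

text \<open>A 1-form sum_i f_i dz_i is represented by its coefficient function i \<mapsto> f_i.\<close>
type_synonym ('a, 'n) form1 = "'n \<Rightarrow> ('a, 'n) mpoly"

definition pconst :: "'a::zero \<Rightarrow> ('a, 'n) mpoly" where
  "pconst c = Poly_Mapping.single 0 c"

definition var :: "'n \<Rightarrow> ('a::{zero,one}, 'n) mpoly" where
  "var i = Poly_Mapping.single (Poly_Mapping.single i 1) 1"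

definition lin_poly :: "'a::field ^ 'n::finite \<Rightarrow> ('a, 'n) mpoly" where
  "lin_poly l = (\<Sum>i\<in>UNIV. pconst (l $ i) * var i)"

definition psubst :: "('n::finite \<Rightarrow> ('a::field, 'n) mpoly) \<Rightarrow> ('a, 'n) mpoly \<Rightarrow> ('a, 'n) mpoly" where
  "psubst \<sigma> p = (\<Sum>m\<in>Poly_Mapping.keys p. pconst (Poly_Mapping.lookup p m) * (\<Prod>i\<in>UNIV. \<sigma> i ^ Poly_Mapping.lookup m i))"

text \<open>(g f)(v) = f(g^{-1} v): on generators, g z_i = sum_j (g^{-1})_{ij} z_j.\<close>
definition act :: "'a::field ^ 'n ^ 'n \<Rightarrow> ('a, 'n::finite) mpoly \<Rightarrow> ('a, 'n) mpoly" where
  "act g p = psubst (\<lambda>i. lin_poly (matrix_inv g $ i)) p"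

text \<open>Diagonal action on 1-forms: g(sum_i f_i dz_i) = sum_i (g f_i) (g dz_i),
  g dz_i = sum_j (g^{-1})_{ij} dz_j.\<close>
definition act_form :: "'a::field ^ 'n ^ 'n \<Rightarrow> ('a, 'n::finite) form1 \<Rightarrow> ('a, 'n) form1" where
  "act_form g \<omega> = (\<lambda>j. \<Sum>i\<in>UNIV. act g (\<omega> i) * pconst (matrix_inv g $ i $ j))"

definition invariants :: "('a::field ^ 'n ^ 'n) set \<Rightarrow> ('a, 'n::finite) mpoly set" where
  "invariants G = {f. \<forall>g\<in>G. act g f = f}"

definition chi_forms :: "('a::field ^ 'n ^ 'n) set \<Rightarrow> ('a ^ 'n ^ 'n \<Rightarrow> 'a) \<Rightarrow> ('a, 'n::finite) form1 set" where
  "chi_forms G chi = {\<omega>. \<forall>g\<in>G. act_form g \<omega> = (\<lambda>j. pconst (chi g) * \<omega> j)}"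

text \<open>omega_1 \<and> ... \<and> omega_n = (top_wedge omega) dz_1 \<and> ... \<and> dz_n.\<close>
definition top_wedge :: "('n::finite \<Rightarrow> ('a::field, 'n) form1) \<Rightarrow> ('a, 'n) mpoly" where
  "top_wedge \<omega> = det (\<chi> k j. \<omega> k j)"

definition lform :: "'a::field ^ 'n::finite \<Rightarrow> 'a ^ 'n \<Rightarrow> 'a" where
  "lform l v = (\<Sum>i\<in>UNIV. l $ i * v $ i)"

definition is_hyperplane :: "('a::field ^ 'n::finite) set \<Rightarrow> bool" where
  "is_hyperplane H \<longleftrightarrow> (\<exists>l. l \<noteq> 0 \<and> H = {v. lform l v = 0})"

definition fixspace :: "'a::field ^ 'n ^ 'n \<Rightarrow> ('a ^ 'n::finite) set" where
  "fixspace g = {v. g *v v = v}"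

definition mpow :: "'a::field ^ 'n ^ 'n \<Rightarrow> nat \<Rightarrow> 'a ^ 'n::finite ^ 'n" where
  "mpow g k = ((\<lambda>A. g ** A) ^^ k) (mat 1)"

definition is_reflection :: "'a::field ^ 'n ^ 'n::finite \<Rightarrow> bool" where
  "is_reflection g \<longleftrightarrow> invertible g \<and> (\<exists>k>0. mpow g k = mat 1) \<and> is_hyperplane (fixspace g)"

definition def_form :: "('a::field ^ 'n::finite) set \<Rightarrow> 'a ^ 'n" where
  "def_form H = (SOME l. l \<noteq> 0 \<and> H = {v. lform l v = 0})"

definition is_transvection :: "'a::field ^ 'n ^ 'n::finite \<Rightarrow> bool" where
  "is_transvection s \<longleftrightarrow> is_reflection s \<and>
     (\<exists>\<alpha>. (\<forall>v. s *v v = v + lform (def_form (fixspace s)) v *s \<alpha>) \<and> lform (def_form (fixspace s)) \<alpha> = 0)"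

definition is_diag_reflection :: "'a::field ^ 'n ^ 'n::finite \<Rightarrow> bool" where
  "is_diag_reflection s \<longleftrightarrow> is_reflection s \<and>
     (\<exists>\<alpha>. (\<forall>v. s *v v = v + lform (def_form (fixspace s)) v *s \<alpha>) \<and> lform (def_form (fixspace s)) \<alpha> \<noteq> 0)"

text \<open>Submonoid generated by S (equals the generated subgroup inside a finite group).\<close>
inductive_set mgen :: "('a::field ^ 'n ^ 'n::finite) set \<Rightarrow> ('a ^ 'n ^ 'n) set" for S where
  mgen_one: "mat 1 \<in> mgen S"
| mgen_mult: "s \<in> S \<Longrightarrow> x \<in> mgen S \<Longrightarrow> s ** x \<in> mgen S"

definition matrix_group :: "('a::field ^ 'n ^ 'n::finite) set \<Rightarrow> bool" where
  "matrix_group G \<longleftrightarrow> finite G \<and> mat 1 \<in> G \<and> (\<forall>g\<in>G. invertible g \<and> matrix_inv g \<in> G)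
     \<and> (\<forall>g\<in>G. \<forall>h\<in>G. g ** h \<in> G)"

definition reflection_group :: "('a::field ^ 'n ^ 'n::finite) set \<Rightarrow> bool" where
  "reflection_group G \<longleftrightarrow> matrix_group G \<and> G = mgen {g\<in>G. is_reflection g}"

definition lin_char :: "('a::field ^ 'n ^ 'n::finite) set \<Rightarrow> ('a ^ 'n ^ 'n \<Rightarrow> 'a) \<Rightarrow> bool" where
  "lin_char G chi \<longleftrightarrow> (\<forall>g\<in>G. chi g \<noteq> 0) \<and> (\<forall>g\<in>G. \<forall>h\<in>G. chi (g ** h) = chi g * chi h)"

definition refl_hyperplanes :: "('a::field ^ 'n ^ 'n::finite) set \<Rightarrow> ('a ^ 'n) set set" where
  "refl_hyperplanes G = {fixspace g | g. g \<in> G \<and> is_reflection g}"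

definition pstab :: "('a::field ^ 'n ^ 'n::finite) set \<Rightarrow> ('a ^ 'n) set \<Rightarrow> ('a ^ 'n ^ 'n) set" where
  "pstab G H = {g\<in>G. \<forall>v\<in>H. g *v v = v}"

definition K_H :: "('a::field ^ 'n ^ 'n::finite) set \<Rightarrow> ('a ^ 'n) set \<Rightarrow> ('a ^ 'n ^ 'n) set" where
  "K_H G H = {g\<in>pstab G H. det g = 1}"

definition e_H :: "('a::field ^ 'n ^ 'n::finite) set \<Rightarrow> ('a ^ 'n) set \<Rightarrow> nat" where
  "e_H G H = card (pstab G H) div card (K_H G H)"

definition has_order :: "'a::field ^ 'n ^ 'n::finite \<Rightarrow> nat \<Rightarrow> bool" where
  "has_order s e \<longleftrightarrow> 0 < e \<and> mpow s e = mat 1 \<and> (\<forall>k. 0 < k \<and> k < e \<longrightarrow> mpow s k \<noteq> mat 1)"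

definition s_H :: "('a::field ^ 'n ^ 'n::finite) set \<Rightarrow> ('a ^ 'n) set \<Rightarrow> 'a ^ 'n ^ 'n" where
  "s_H G H = (SOME s. s \<in> pstab G H \<and> has_order s (e_H G H)
      \<and> pstab G H = mgen (insert s (K_H G H))
      \<and> (if e_H G H = 1 then s = mat 1 else is_diag_reflection s))"

definition trans_roots :: "('a::field ^ 'n ^ 'n::finite) set \<Rightarrow> ('a ^ 'n) set \<Rightarrow> ('a ^ 'n) set" where
  "trans_roots G H = {\<alpha>. \<exists>t\<in>pstab G H. is_transvection t \<and>
       (\<forall>v. t *v v = v + lform (def_form H) v *s \<alpha>)}"

definition b_H :: "('a::field ^ 'n ^ 'n::finite) set \<Rightarrow> ('a ^ 'n) set \<Rightarrow> nat" where
  "b_H G H = vec.dim (trans_roots G H)"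

definition a_H :: "('a::field ^ 'n ^ 'n::finite) set \<Rightarrow> ('a ^ 'n) set \<Rightarrow> ('a ^ 'n ^ 'n \<Rightarrow> 'a) \<Rightarrow> nat" where
  "a_H G H psi = (LEAST a. psi (s_H G H) = inverse (det (s_H G H)) ^ a)"

definition Q_char :: "('a::field ^ 'n ^ 'n::finite) set \<Rightarrow> ('a ^ 'n ^ 'n \<Rightarrow> 'a) \<Rightarrow> ('a, 'n) mpoly" where
  "Q_char G psi = (\<Prod>H\<in>refl_hyperplanes G. lin_poly (def_form H) ^ a_H G H psi)"

definition Q_tilde :: "('a::field ^ 'n ^ 'n::finite) set \<Rightarrow> ('a ^ 'n ^ 'n \<Rightarrow> 'a) \<Rightarrow> ('a, 'n) mpoly" where
  "Q_tilde G chi = (\<Prod>H\<in>{H\<in>refl_hyperplanes G. chi (s_H G H) = 1}.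
       lin_poly (def_form H) ^ (e_H G H * b_H G H))"

end

theory Submission
  imports Defs "HOL-Computational_Algebra.Primes" "HOL-Computational_Algebra.Polynomial"
begin

text \<open>
  By Cramer's rule, a \<open>\<chi>\<close>-invariant form \<open>\<eta>\<close> times \<open>D = \<omega>\<^sub>1 \<and> \<dots> \<and> \<omega>\<^sub>n\<close> is the combination of the
  \<open>\<omega>\<^sub>k\<close> with coefficients \<open>W\<^sub>k\<close>, the wedge with \<open>\<omega>\<^sub>k\<close> replaced by \<open>\<eta>\<close>. As \<open>D\<close> and \<open>W\<^sub>k\<close> transform by
  the same character, it suffices that \<open>D\<close> divides the wedge of any \<open>n\<close> \<open>\<chi>\<close>-invariant forms, and
  since the \<open>l\<^sub>H\<close> are pairwise non-associated primes this may be checked for one hyperplane at a time.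

  Contract the forms with a basis of \<open>V\<close> made of an eigenvector \<open>\<alpha>\<close> of \<open>s\<^sub>H\<close> outside \<open>H\<close>, a basis of
  the span of the transvection roots, and further vectors of \<open>H\<close>. Every \<open>g\<close> in \<open>G\<^sub>H\<close> satisfies
  \<open>l\<^sub>H dvd g f - f\<close>, so semi-invariance under \<open>s\<^sub>H\<close> makes the contraction with \<open>\<alpha>\<close> divisible by \<open>l\<^sub>H\<close>
  to the power \<open>a\<^sub>H(\<chi> det)\<close> and those with vectors of \<open>H\<close> by \<open>l\<^sub>H\<close> to the power \<open>a\<^sub>H(\<chi>)\<close>. If
  \<open>\<chi>(s\<^sub>H) = 1\<close>, a transvection with root \<open>\<beta>\<close> moves the contraction with \<open>\<alpha>\<close> by a multiple of the one
  with \<open>\<beta>\<close>, so the latter gains one more factor and is divisible by \<open>l\<^sub>H\<close> to the power \<open>e\<^sub>H\<close>.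
\<close>

subsection \<open>Ring homomorphisms\<close>

locale comm_ring_hom = additive f for f :: "'r::comm_ring_1 \<Rightarrow> 's::comm_ring_1" +
  assumes one: "f 1 = 1" and mult: "f (x * y) = f x * f y"
begin

lemma power: "f (x ^ k) = f x ^ k"
  by (induction k) (simp_all add: one mult)

lemma prod: "f (\<Prod>i\<in>I. g i) = (\<Prod>i\<in>I. f (g i))"
  by (induction I rule: infinite_finite_induct) (simp_all add: one mult)

lemma of_int: "f (of_int k) = of_int k"
proof -
  have of_nat: "f (of_nat n) = of_nat n" for n
    by (induction n) (simp_all add: zero one add)
  show ?thesis
    by (cases k) (simp_all add: of_nat one minus diff)
qed

lemma det: "f (det A) = det (\<chi> i j. f (A $ i $ j))"
  by (simp add: det_def sum mult prod of_int)

end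

subsection \<open>Finitely supported functions\<close>

definition monoid_algebra_lift ::
    "('a::zero \<Rightarrow> 'r::comm_ring_1) \<Rightarrow> ('m \<Rightarrow> 'r) \<Rightarrow> ('m \<Rightarrow>\<^sub>0 'a) \<Rightarrow> 'r" where
  "monoid_algebra_lift c h p = (\<Sum>m\<in>Poly_Mapping.keys p. c (Poly_Mapping.lookup p m) * h m)"

lemma poly_mapping_eq_sum_single:
  "p = (\<Sum>m\<in>Poly_Mapping.keys p. Poly_Mapping.single m (Poly_Mapping.lookup p m))"
  by (rule poly_mapping_eqI) (simp add: lookup_sum lookup_single when_def in_keys_iff)

lemma monoid_algebra_lift_single:
  "c 0 = 0 \<Longrightarrow> monoid_algebra_lift c h (Poly_Mapping.single m x) = c x * h m"
  by (simp add: monoid_algebra_lift_def)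

lemma comm_ring_hom_monoid_algebra_lift:
  fixes c :: "'a::comm_ring_1 \<Rightarrow> 'r::comm_ring_1" and h :: "'m::comm_monoid_add \<Rightarrow> 'r"
  assumes "comm_ring_hom c" and h_zero: "h 0 = 1" and h_add: "\<And>m m'. h (m + m') = h m * h m'"
  shows "comm_ring_hom (monoid_algebra_lift c h)"
proof -
  interpret c: comm_ring_hom c by fact
  let ?lift = "monoid_algebra_lift c h"
  have single: "?lift (Poly_Mapping.single m x) = c x * h m" for m x
    by (simp add: monoid_algebra_lift_single c.zero)
  interpret lift: additive ?lift
    unfolding monoid_algebra_lift_def
    by unfold_locales (intro setsum_keys_plus_distrib, simp_all add: c.zero c.add distrib_right)
  show ?thesis
  proof
    show "?lift 1 = 1"
      using single[of 0 1] by (simp add: c.one h_zero)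
  next
    fix p q :: "'m \<Rightarrow>\<^sub>0 'a"
    let ?l = Poly_Mapping.lookup and ?k = Poly_Mapping.keys
    have "p * q
        = (\<Sum>m\<in>?k p. \<Sum>m'\<in>?k q. Poly_Mapping.single m (?l p m) * Poly_Mapping.single m' (?l q m'))"
      by (simp only: sum_product[symmetric] poly_mapping_eq_sum_single[symmetric])
    also have "?lift \<dots> = (\<Sum>m\<in>?k p. \<Sum>m'\<in>?k q. (c (?l p m) * h m) * (c (?l q m') * h m'))"
      by (simp add: lift.sum single mult_single h_add c.mult mult_ac)
    also have "\<dots> = ?lift p * ?lift q"
      by (simp add: monoid_algebra_lift_def sum_product)
    finally show "?lift (p * q) = ?lift p * ?lift q" .
  qed
qed

text \<open>The library knows this only for linearly ordered monoids, and the exponent vectors over an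
  arbitrary finite type carry no such order.\<close>

lemma poly_mapping_no_zero_divisors:
  fixes e :: "'m::comm_monoid_add \<Rightarrow> 'l::{ordered_cancel_comm_monoid_add, linorder}"
    and p q :: "'m \<Rightarrow>\<^sub>0 'a::idom"
  assumes "inj e" "e 0 = 0" "\<And>m m'. e (m + m') = e m + e m'" and "p * q = 0"
  shows "p = 0 \<or> q = 0"
proof -
  let ?push = "monoid_algebra_lift (Poly_Mapping.single 0) (\<lambda>m. Poly_Mapping.single (e m) 1)
    :: ('m \<Rightarrow>\<^sub>0 'a) \<Rightarrow> ('l \<Rightarrow>\<^sub>0 'a)"
  interpret push: comm_ring_hom ?push
    by (intro comm_ring_hom_monoid_algebra_lift; (unfold_locales)?)
      (simp_all add: single_add mult_single assms(2,3))
  have lookup_push: "Poly_Mapping.lookup (?push r) (e m) = Poly_Mapping.lookup r m" for r m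
  proof -
    have "Poly_Mapping.lookup (?push r) (e m)
        = (\<Sum>k\<in>Poly_Mapping.keys r. if k = m then Poly_Mapping.lookup r k else 0)"
      unfolding monoid_algebra_lift_def lookup_sum mult_single
      by (intro sum.cong refl) (simp add: lookup_single when_def inj_eq[OF assms(1)])
    also have "\<dots> = Poly_Mapping.lookup r m"
      by (simp add: in_keys_iff)
    finally show ?thesis .
  qed
  have "?push p * ?push q = 0"
    using assms(4) push.mult[of p q] by (simp add: push.zero)
  then have "?push p = 0 \<or> ?push q = 0"
    by simp
  then show ?thesis
    using lookup_push by (metis lookup_zero poly_mapping_eqI)
qed

subsection \<open>The polynomial ring\<close>

interpretation pconst: comm_ring_hom "pconst :: 'a::comm_ring_1 \<Rightarrow> ('a, 'n) mpoly"
  by unfold_locales (simp_all add: pconst_def single_add mult_single)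

declare pconst.zero [simp] pconst.one [simp]

lemma pconst_eq_0_iff [simp]: "pconst x = 0 \<longleftrightarrow> x = 0"
  by (metis lookup_single_eq lookup_zero pconst_def single_zero)

lemma pconst_inverse: "x \<noteq> 0 \<Longrightarrow> pconst x * pconst (inverse x) = 1" for x :: "'a::field"
  by (simp flip: pconst.mult)

lemma
  fixes x :: "'a::field"
  assumes "x \<noteq> 0"
  shows dvd_pconst_mult_iff: "p dvd pconst x * q \<longleftrightarrow> p dvd q"
    and pconst_mult_dvd_iff: "pconst x * p dvd q \<longleftrightarrow> p dvd q"
proof -
  have unit: "pconst (inverse x) * (pconst x * r) = r" for r :: "('a, 'b) mpoly"
    using pconst_inverse[OF assms, where 'b = 'b] by (metis mult.assoc mult.commute mult_1)
  show "p dvd pconst x * q \<longleftrightarrow> p dvd q" for p q :: "('a, 'b) mpoly"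
    by (metis dvd_mult unit)
  then show "pconst x * p dvd q \<longleftrightarrow> p dvd q"
    by (metis dvd_mult_right dvd_refl dvd_trans)
qed

lemma ex_exponent_embedding:
  "\<exists>e :: ('n::finite \<Rightarrow>\<^sub>0 nat) \<Rightarrow> (nat \<Rightarrow>\<^sub>0 nat). inj e \<and> e 0 = 0 \<and> (\<forall>m m'. e (m + m') = e m + e m')"
proof -
  obtain idx :: "'n \<Rightarrow> nat" where idx: "inj idx"
    using finite_imp_inj_to_nat_seg[of "UNIV :: 'n set"] by auto
  define e :: "('n \<Rightarrow>\<^sub>0 nat) \<Rightarrow> (nat \<Rightarrow>\<^sub>0 nat)" where
    "e m = (\<Sum>i\<in>UNIV. Poly_Mapping.single (idx i) (Poly_Mapping.lookup m i))" for m
  have "Poly_Mapping.lookup (e m) (idx i) = Poly_Mapping.lookup m i" for m i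
    by (simp add: e_def lookup_sum lookup_single when_def inj_eq[OF idx])
  then have "inj e"
    by (metis injI poly_mapping_eqI)
  moreover have "e 0 = 0" "e (m + m') = e m + e m'" for m m'
    by (simp_all add: e_def lookup_add single_add sum.distrib)
  ultimately show ?thesis
    by blast
qed

lemma mpoly_mult_eq_0_iff [simp]:
  fixes p q :: "('a::field, 'n::finite) mpoly"
  shows "p * q = 0 \<longleftrightarrow> p = 0 \<or> q = 0"
  using ex_exponent_embedding poly_mapping_no_zero_divisors by (metis mult_zero_left mult_zero_right)

lemma mpoly_mult_cancel_left:
  fixes p q r :: "('a::field, 'n::finite) mpoly"
  shows "r * p = r * q \<longleftrightarrow> r = 0 \<or> p = q"
  using mpoly_mult_eq_0_iff[of r "p - q"] by (auto simp: right_diff_distrib)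

lemma mpoly_power_eq_0_iff [simp]:
  fixes p :: "('a::field, 'n::finite) mpoly"
  shows "p ^ k = 0 \<longleftrightarrow> p = 0 \<and> k > 0"
  by (induction k) auto

lemma mpoly_prod_eq_0_iff:
  fixes f :: "'i \<Rightarrow> ('a::field, 'n::finite) mpoly"
  assumes "finite I"
  shows "prod f I = 0 \<longleftrightarrow> (\<exists>i\<in>I. f i = 0)"
  using assms by induction auto

lemma single_eq_monomial:
  fixes m :: "'n::finite \<Rightarrow>\<^sub>0 nat" and x :: "'a::comm_ring_1"
  shows "Poly_Mapping.single m x = pconst x * (\<Prod>i\<in>UNIV. var i ^ Poly_Mapping.lookup m i)"
proof -
  have var_power: "var i ^ k = Poly_Mapping.single (Poly_Mapping.single i k) (1::'a)" for i :: 'n and k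
    by (induction k) (auto simp: var_def mult_single simp flip: single_add)
  have "(\<Prod>i\<in>I. var i ^ Poly_Mapping.lookup m i)
      = Poly_Mapping.single (\<Sum>i\<in>I. Poly_Mapping.single i (Poly_Mapping.lookup m i)) (1::'a)"
    if "finite I" for I :: "'n set"
    using that by induction (auto simp: var_power mult_single)
  moreover have "(\<Sum>i\<in>UNIV. Poly_Mapping.single i (Poly_Mapping.lookup m i)) = m"
    by (rule poly_mapping_eqI) (simp add: lookup_sum lookup_single when_def)
  ultimately show ?thesis
    by (simp add: pconst_def mult_single)
qed

lemma mpoly_induct [case_names pconst var add mult]:
  fixes p :: "('a::comm_ring_1, 'n::finite) mpoly"
  assumes pconst: "\<And>x. P (pconst x)" and var: "\<And>i. P (var i)"
    and add: "\<And>p q. P p \<Longrightarrow> P q \<Longrightarrow> P (p + q)" and mult: "\<And>p q. P p \<Longrightarrow> P q \<Longrightarrow> P (p * q)"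
  shows "P p"
proof -
  have zero: "P 0" and one: "P 1"
    using pconst[of 0] pconst[of 1] by simp_all
  have "P (var i ^ k)" for i k
    by (induction k) (auto intro: one var mult)
  then have "P (\<Prod>i\<in>I. var i ^ Poly_Mapping.lookup m i)" for I and m :: "'n \<Rightarrow>\<^sub>0 nat"
    by (induction I rule: infinite_finite_induct) (auto intro: one mult)
  then have "P (Poly_Mapping.single m x)" for m x
    by (auto simp: single_eq_monomial intro: pconst mult)
  then have "P (\<Sum>m\<in>M. Poly_Mapping.single m (f m))" for M f
    by (induction M rule: infinite_finite_induct) (auto intro: zero add)
  then show ?thesis
    by (metis poly_mapping_eq_sum_single)
qed

interpretation psubst: comm_ring_hom "psubst \<sigma>"
  for \<sigma> :: "'n::finite \<Rightarrow> ('a::field, 'n) mpoly"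
proof -
  have "comm_ring_hom (monoid_algebra_lift pconst (\<lambda>m. \<Prod>i\<in>UNIV. \<sigma> i ^ Poly_Mapping.lookup m i))"
    by (intro comm_ring_hom_monoid_algebra_lift pconst.comm_ring_hom_axioms)
      (simp_all add: lookup_add power_add prod.distrib)
  moreover have "monoid_algebra_lift pconst (\<lambda>m. \<Prod>i\<in>UNIV. \<sigma> i ^ Poly_Mapping.lookup m i) = psubst \<sigma>"
    by (simp add: fun_eq_iff monoid_algebra_lift_def psubst_def)
  ultimately show "comm_ring_hom (psubst \<sigma>)"
    by simp
qed

lemma psubst_pconst [simp]: "psubst \<sigma> (pconst x) = pconst x"
  by (simp add: psubst_def pconst_def)

lemma psubst_var [simp]: "psubst \<sigma> (var i) = \<sigma> i"
  by (simp add: psubst_def var_def lookup_single when_def if_distrib cong: if_cong)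

lemma dvd_psubst_diff:
  assumes "\<And>i. q dvd \<sigma> i - var i"
  shows "q dvd psubst \<sigma> p - p"
proof (induction p rule: mpoly_induct)
  case (add p r)
  have "psubst \<sigma> (p + r) - (p + r) = (psubst \<sigma> p - p) + (psubst \<sigma> r - r)"
    by (simp add: psubst.add)
  with add show ?case by (metis dvd_add)
next
  case (mult p r)
  have "psubst \<sigma> (p * r) - p * r = (psubst \<sigma> p - p) * psubst \<sigma> r + p * (psubst \<sigma> r - r)"
    by (simp add: psubst.mult algebra_simps)
  with mult show ?case by (metis dvd_add dvd_mult dvd_mult2)
qed (use assms in auto)

subsection \<open>Prime elements that cancel\<close>

lemma prime_elem_power_dvd_multD:
  fixes p a b :: "'r::comm_semiring_1"
  assumes prime: "prime_elem p" and cancel: "\<And>x y. p * x = p * y \<Longrightarrow> x = y"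
    and "\<not> p dvd a" "p ^ k dvd a * b"
  shows "p ^ k dvd b"
  using assms(4)
proof (induction k arbitrary: b)
  case (Suc k)
  have "p dvd a * b"
    using Suc.prems by (auto intro: dvd_mult_left)
  then obtain b' where b: "b = p * b'"
    using prime_elem_dvd_multD[OF prime] assms(3) by (meson dvdE)
  from Suc.prems obtain r where "a * b = p ^ Suc k * r" ..
  then have "p * (a * b') = p * (p ^ k * r)"
    by (simp add: b mult_ac)
  then have "a * b' = p ^ k * r"
    by (rule cancel)
  then have "p ^ k dvd b'"
    by (simp add: Suc.IH)
  then show ?case
    by (simp add: b mult_dvd_mono)
qed simp

lemma prime_elem_dvd_prodE:
  fixes p :: "'r::comm_semiring_1"
  assumes "prime_elem p" "p dvd (\<Prod>i\<in>I. f i)"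
  obtains i where "i \<in> I" "p dvd f i"
proof -
  have "\<exists>i\<in>I. p dvd f i"
    using assms(2)
    by (induction I rule: infinite_finite_induct)
      (use assms(1) in \<open>auto simp: prime_elem_dvd_mult_iff prime_elem_not_unit\<close>)
  then show ?thesis
    using that by blast
qed

lemma prod_prime_elem_power_dvd:
  fixes p :: "'i \<Rightarrow> 'r::comm_semiring_1"
  assumes "finite I" "\<And>i. i \<in> I \<Longrightarrow> prime_elem (p i)"
    and "\<And>i x y. i \<in> I \<Longrightarrow> p i * x = p i * y \<Longrightarrow> x = y"
    and "\<And>i j. i \<in> I \<Longrightarrow> j \<in> I \<Longrightarrow> p i dvd p j \<Longrightarrow> i = j"
    and "\<And>i. i \<in> I \<Longrightarrow> p i ^ k i dvd w"
  shows "(\<Prod>i\<in>I. p i ^ k i) dvd w"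
  using assms
proof (induction I rule: finite_induct)
  case (insert i I)
  let ?P = "\<Prod>j\<in>I. p j ^ k j"
  have "?P dvd w"
    using insert.prems by (intro insert.IH) blast+
  then obtain q where q: "w = ?P * q" ..
  have "\<not> p i dvd ?P"
  proof
    assume "p i dvd ?P"
    then obtain j where "j \<in> I" "p i dvd p j ^ k j"
      using insert.prems(1) by (auto elim: prime_elem_dvd_prodE)
    then show False
      using insert.hyps insert.prems(1,3) prime_elem_dvd_power by (metis insertCI)
  qed
  moreover have "p i ^ k i dvd ?P * q"
    using insert.prems(4) unfolding q by blast
  ultimately have "p i ^ k i dvd q"
    using prime_elem_power_dvd_multD[of "p i" ?P "k i" q] insert.prems(1,2) by blast
  then have "p i ^ k i * ?P dvd w"
    unfolding q by (metis dvd_refl mult.commute mult_dvd_mono)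
  then show ?case
    using insert.hyps by simp
qed simp

subsection \<open>Adjugate matrices\<close>

definition adjugate :: "'r::comm_ring_1 ^ 'n::finite ^ 'n \<Rightarrow> 'r ^ 'n ^ 'n" where
  "adjugate A = (\<chi> j k. det (\<chi> i. if i = k then axis j 1 else A $ i))"

lemma det_replace_row:
  "det (\<chi> i. if i = k then y else A $ i) = (y v* adjugate A) $ k"
proof -
  have "det (\<chi> i. if i = k then y else A $ i)
      = det (\<chi> i. if i = k then (\<Sum>j\<in>UNIV. y $ j *s axis j 1) else A $ i)"
    by (simp only: basis_expansion)
  also have "\<dots> = (\<Sum>j\<in>UNIV. det (\<chi> i. if i = k then y $ j *s axis j 1 else A $ i))"
    by (rule det_linear_row_sum) simp
  also have "\<dots> = (y v* adjugate A) $ k"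
    by (simp add: adjugate_def det_row_mul vector_matrix_mult_def)
  finally show ?thesis .
qed

lemma matrix_mult_adjugate: "A ** adjugate A = mat (det A)"
proof -
  have "(A $ i v* adjugate A) $ k = mat (det A) $ i $ k" for i k
  proof (cases "i = k")
    case True
    then have "(\<chi> m. if m = k then A $ i else A $ m) = A"
      by (simp add: vec_eq_iff)
    with True show ?thesis
      by (simp only: mat_def flip: det_replace_row) simp
  next
    case False
    then show ?thesis
      by (simp add: mat_def det_identical_rows[of i k] row_def flip: det_replace_row)
  qed
  then show ?thesis
    by (simp add: vec_eq_iff matrix_matrix_mult_def vector_matrix_mult_def)
qed

text \<open>Replacing row \<open>k\<close> by the \<open>j\<close>th unit vector and replacing column \<open>j\<close> by the \<open>k\<close>th one leave
  the same nonzero terms in the Leibniz formula.\<close>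

lemma adjugate_transpose:
  fixes A :: "'r::comm_ring_1 ^ 'n::finite ^ 'n"
  shows "adjugate (transpose A) = transpose (adjugate A)"
proof -
  have "(\<Prod>i\<in>UNIV. (if i = k then axis j 1 else A $ i) $ p i)
      = (\<Prod>i\<in>UNIV. if p i = j then axis k 1 $ i else A $ i $ p i)"
    if p: "p permutes UNIV" for p and j k :: 'n
  proof (cases "p k = j")
    case True
    then have "p i = j \<longleftrightarrow> i = k" for i
      using permutes_inj[OF p] by (auto simp: inj_def)
    with True show ?thesis
      by (intro prod.cong) (auto simp: axis_def)
  next
    case False
    obtain m where "p m = j"
      using permutes_surj[OF p] by (metis surjD)
    moreover with False have "m \<noteq> k"
      by blast
    ultimately show ?thesis
      using False by (subst (1 2) prod_zero) (auto simp: axis_def intro: bexI[of _ k] bexI[of _ m])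
  qed
  then have "adjugate A $ j $ k = det (\<chi> i m. if m = j then axis k 1 $ i else A $ i $ m)" for j k
    by (simp add: adjugate_def det_def)
  moreover have "adjugate (transpose A) $ k $ j
      = det (transpose (\<chi> i m. if m = j then axis k 1 $ i else A $ i $ m))" for j k
    unfolding adjugate_def
    by (simp del: det_transpose) (rule arg_cong[of _ _ det], simp add: vec_eq_iff transpose_def)
  ultimately show ?thesis
    by (simp add: vec_eq_iff transpose_def[of "adjugate A"])
qed

lemma adjugate_matrix_mult: "adjugate A ** A = mat (det A)"
proof -
  have "transpose (adjugate A ** A) = mat (det A)"
    by (metis adjugate_transpose det_transpose matrix_mult_adjugate matrix_transpose_mul)
  then show ?thesis
    by (metis transpose_mat transpose_transpose)
qed

lemma adjugate_mat_1: "adjugate (mat 1 :: 'r::comm_ring_1 ^ 'n::finite ^ 'n) = mat 1"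
  by (metis det_I matrix_mul_lid matrix_mult_adjugate)

lemma det_mat_1_replace_row:
  fixes y :: "'r::comm_ring_1 ^ 'n::finite"
  shows "det (\<chi> i. if i = k then y else mat 1 $ i) = y $ k"
  by (simp add: det_replace_row adjugate_mat_1)

lemma det_mat_1_replace_column:
  fixes y :: "'r::comm_ring_1 ^ 'n::finite"
  shows "det (\<chi> i j. if j = k then y $ i else mat 1 $ i $ j) = y $ k"
proof -
  have "transpose (\<chi> i j. if j = k then y $ i else mat 1 $ i $ j)
      = (\<chi> i. if i = k then y else mat 1 $ i)"
    by (simp add: vec_eq_iff transpose_def mat_def)
  from arg_cong[OF this, of det] show ?thesis
    by (simp only: det_transpose det_mat_1_replace_row)
qed

lemma vector_matrix_mult_mat: "v v* mat c = c *s v" for c :: "'r::comm_ring_1"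
  by (simp add: vec_eq_iff vector_matrix_mult_def mat_def if_distrib cong: if_cong)

lemma power_dvd_det_of_columns:
  fixes M :: "'r::comm_ring_1 ^ 'n::finite ^ 'n"
  assumes "\<And>i j. x ^ k j dvd M $ i $ j"
  shows "x ^ (\<Sum>j\<in>UNIV. k j) dvd det M"
  unfolding det_def
proof (intro dvd_sum dvd_mult)
  fix p assume "p \<in> {p. p permutes (UNIV :: 'n set)}"
  then have "(\<Sum>j\<in>UNIV. k j) = (\<Sum>i\<in>UNIV. k (p i))"
    using sum.permute[of p UNIV k] by (simp add: comp_def)
  then have "x ^ (\<Sum>j\<in>UNIV. k j) = (\<Prod>i\<in>UNIV. x ^ k (p i))"
    by (simp add: power_sum)
  also have "\<dots> dvd (\<Prod>i\<in>UNIV. M $ i $ p i)"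
    by (intro prod_dvd_prod) (auto intro: assms)
  finally show "x ^ (\<Sum>j\<in>UNIV. k j) dvd (\<Prod>i\<in>UNIV. M $ i $ p i)" .
qed

subsection \<open>Linear forms and linear substitutions\<close>

interpretation lform: Vector_Spaces.linear "(*s)" "(*)" "lform l" for l :: "'a::field ^ 'n::finite"
  by unfold_locales
    (simp_all add: lform_def distrib_left distrib_right sum.distrib sum_distrib_left mult_ac)

lemma lform_axis: "lform l (axis j 1) = l $ j"
  by (simp add: lform_def axis_def if_distrib cong: if_cong)

lemma lform_commute: "lform l v = lform v l"
  by (simp add: lform_def mult.commute)

lemma matrix_vector_mult_nth: "(A *v v) $ i = lform v (A $ i)"
  by (simp add: matrix_vector_mult_def lform_def mult.commute)

lemma ex_lform_eq_1:
  assumes "l \<noteq> 0"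
  obtains u where "lform l u = 1"
proof -
  obtain j where "l $ j \<noteq> 0"
    using assms by (auto simp: vec_eq_iff)
  then have "lform l (inverse (l $ j) *s axis j 1) = 1"
    by (simp add: lform.scale lform_axis)
  then show ?thesis ..
qed

lemma lin_poly_add: "lin_poly (u + v) = lin_poly u + lin_poly v"
  by (simp add: lin_poly_def pconst.add distrib_right sum.distrib)

lemma lin_poly_scale: "lin_poly (x *s u) = pconst x * lin_poly u"
  by (simp add: lin_poly_def pconst.mult sum_distrib_left mult.assoc)

lemma lin_poly_axis: "lin_poly (axis i 1) = var i"
  by (simp add: lin_poly_def axis_def if_distrib if_distribR cong: if_cong)

lemma lookup_lin_poly: "Poly_Mapping.lookup (lin_poly l) (Poly_Mapping.single j 1) = l $ j"
proof -
  have "Poly_Mapping.single i (1::nat) = Poly_Mapping.single j 1 \<longleftrightarrow> i = j" for i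
    by (metis lookup_single_eq lookup_single_not_eq zero_neq_one)
  then show ?thesis
    by (simp add: lin_poly_def pconst_def var_def mult_single lookup_sum lookup_single when_def
        del: One_nat_def)
qed

lemma lin_poly_eq_0_iff [simp]: "lin_poly l = 0 \<longleftrightarrow> l = 0"
proof
  assume "lin_poly l = 0"
  then show "l = 0"
    by (metis lookup_lin_poly lookup_zero vec_eq_iff zero_index)
qed (simp add: lin_poly_def)

definition linear_subst :: "'a::field ^ 'n ^ 'n::finite \<Rightarrow> ('a, 'n) mpoly \<Rightarrow> ('a, 'n) mpoly" where
  "linear_subst A = psubst (\<lambda>i. lin_poly (A $ i))"

lemma act_eq_linear_subst: "act g = linear_subst (matrix_inv g)"
  by (simp add: fun_eq_iff act_def linear_subst_def)

interpretation linear_subst: comm_ring_hom "linear_subst A"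
  for A :: "'a::field ^ 'n ^ 'n::finite"
  unfolding linear_subst_def by (rule psubst.comm_ring_hom_axioms)

interpretation act: comm_ring_hom "act g"
  for g :: "'a::field ^ 'n ^ 'n::finite"
  unfolding act_eq_linear_subst by (rule linear_subst.comm_ring_hom_axioms)

lemma act_pconst [simp]: "act g (pconst x) = pconst x"
  by (simp add: act_def)

lemma linear_subst_lin_poly: "linear_subst A (lin_poly l) = lin_poly (l v* A)"
proof -
  have "linear_subst A (lin_poly l)
      = (\<Sum>i\<in>UNIV. \<Sum>j\<in>UNIV. pconst (l $ i) * (pconst (A $ i $ j) * var j))"
    by (simp add: linear_subst_def lin_poly_def[of l] psubst.sum psubst.mult)
      (simp add: lin_poly_def sum_distrib_left)
  also have "\<dots> = (\<Sum>j\<in>UNIV. \<Sum>i\<in>UNIV. pconst (l $ i) * (pconst (A $ i $ j) * var j))"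
    by (rule sum.swap)
  also have "\<dots> = lin_poly (l v* A)"
    by (simp add: lin_poly_def vector_matrix_mult_def pconst.sum pconst.mult sum_distrib_left mult_ac)
  finally show ?thesis .
qed

subsection \<open>Pseudoreflections\<close>

definition pseudoreflection :: "'a::field ^ 'n \<Rightarrow> 'a ^ 'n \<Rightarrow> 'a ^ 'n ^ 'n::finite" where
  "pseudoreflection l \<alpha> = (\<chi> i. axis i 1 + \<alpha> $ i *s l)"

lemma pseudoreflection_mult_vec: "pseudoreflection l \<alpha> *v v = v + lform l v *s \<alpha>"
proof -
  have "(pseudoreflection l \<alpha> *v v) $ i = (v + lform l v *s \<alpha>) $ i" for i
    by (simp add: matrix_vector_mult_nth pseudoreflection_def lform.add lform.scale lform_axis
        lform_commute[of l] mult.commute)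
  then show ?thesis
    by (simp add: vec_eq_iff)
qed

lemma transpose_pseudoreflection: "transpose (pseudoreflection l \<alpha>) = pseudoreflection \<alpha> l"
  by (simp add: vec_eq_iff transpose_def pseudoreflection_def axis_def mult.commute)

lemma vec_mult_pseudoreflection: "m v* pseudoreflection l \<alpha> = m + lform m \<alpha> *s l"
  by (metis lform_commute pseudoreflection_mult_vec transpose_matrix_vector transpose_pseudoreflection)

lemma pseudoreflection_eqI: "(\<And>v. g *v v = v + lform l v *s \<alpha>) \<Longrightarrow> g = pseudoreflection l \<alpha>"
  by (simp add: matrix_eq pseudoreflection_mult_vec)

lemma pseudoreflection_0 [simp]: "pseudoreflection l 0 = mat 1"
  by (rule pseudoreflection_eqI[symmetric]) simp

lemma pseudoreflection_eq_iff:
  assumes "l \<noteq> 0"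
  shows "pseudoreflection l \<alpha> = pseudoreflection l \<beta> \<longleftrightarrow> \<alpha> = \<beta>"
proof
  obtain u where u: "lform l u = 1"
    using assms by (rule ex_lform_eq_1)
  assume "pseudoreflection l \<alpha> = pseudoreflection l \<beta>"
  then have "pseudoreflection l \<alpha> *v u = pseudoreflection l \<beta> *v u"
    by (rule arg_cong)
  then show "\<alpha> = \<beta>"
    by (simp add: pseudoreflection_mult_vec u)
qed simp

lemma fixspace_pseudoreflection:
  "\<alpha> \<noteq> 0 \<Longrightarrow> fixspace (pseudoreflection l \<alpha>) = {v. lform l v = 0}"
  by (simp add: fixspace_def pseudoreflection_mult_vec)

lemma fixes_hyperplane_imp_pseudoreflection:
  assumes "l \<noteq> 0" and fix_ker: "\<And>v. lform l v = 0 \<Longrightarrow> g *v v = v"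
  obtains \<alpha> where "g = pseudoreflection l \<alpha>"
proof -
  obtain u where u: "lform l u = 1"
    using assms(1) by (rule ex_lform_eq_1)
  have "g *v v = v + lform l v *s (g *v u - u)" for v
  proof -
    have "g *v (v - lform l v *s u) = v - lform l v *s u"
      by (intro fix_ker) (simp add: lform.diff lform.scale u)
    then have "g *v v = v - lform l v *s u + lform l v *s (g *v u)"
      by (simp only: vec.diff vec.scale diff_eq_eq)
    then show ?thesis
      by (simp only: vector_ssub_ldistrib) simp
  qed
  then show ?thesis
    using that pseudoreflection_eqI by blast
qed

lemma pseudoreflection_mult:
  "pseudoreflection l \<alpha> ** pseudoreflection l \<beta>
    = pseudoreflection l (\<beta> + (1 + lform l \<beta>) *s \<alpha>)"
proof (rule pseudoreflection_eqI)
  fix v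
  have "(pseudoreflection l \<alpha> ** pseudoreflection l \<beta>) *v v
      = pseudoreflection l \<alpha> *v (pseudoreflection l \<beta> *v v)"
    by (simp only: matrix_vector_mul_assoc)
  also have "\<dots> = v + lform l v *s (\<beta> + (1 + lform l \<beta>) *s \<alpha>)"
    by (simp add: pseudoreflection_mult_vec lform.add lform.scale vec_eq_iff
        distrib_left distrib_right)
  finally show "(pseudoreflection l \<alpha> ** pseudoreflection l \<beta>) *v v
      = v + lform l v *s (\<beta> + (1 + lform l \<beta>) *s \<alpha>)" .
qed

lemma mat_1_nth: "mat 1 $ i = axis i 1"
  by (simp add: vec_eq_iff mat_def axis_def)

lemma axis_vec_mult: "axis i 1 v* A = A $ i" for A :: "'a::semiring_1 ^ 'n ^ 'm::finite"
  by (simp add: vec_eq_iff vector_matrix_mult_def axis_def if_distrib if_distribR cong: if_cong)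

text \<open>With \<open>L\<close> the unit matrix whose row \<open>j\<close> is replaced by \<open>l\<close>, row operations give
  \<open>L g = M L\<close> for a matrix \<open>M\<close> that differs from the unit matrix only in column \<open>j\<close>.\<close>

lemma det_pseudoreflection: "det (pseudoreflection l \<alpha>) = 1 + lform l \<alpha>"
proof (cases "l = 0")
  case True
  then have "pseudoreflection l \<alpha> = mat 1"
    by (simp add: matrix_eq pseudoreflection_mult_vec lform_def)
  with True show ?thesis
    by (simp add: lform_def)
next
  case False
  then obtain j where j: "l $ j \<noteq> 0"
    by (auto simp: vec_eq_iff)
  define y where "y = (\<chi> i. if i = j then 1 + lform l \<alpha> else \<alpha> $ i)"
  define L :: "'a ^ 'b ^ 'b" where "L = (\<chi> i. if i = j then l else mat 1 $ i)"
  define M :: "'a ^ 'b ^ 'b" where "M = (\<chi> i m. if m = j then y $ i else mat 1 $ i $ m)"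
  have det_L: "det L = l $ j" and det_M: "det M = 1 + lform l \<alpha>"
    by (simp_all add: L_def det_mat_1_replace_row M_def det_mat_1_replace_column y_def)
  have "L $ i v* pseudoreflection l \<alpha> = M $ i v* L" for i
  proof (cases "i = j")
    case True
    then have "M $ i = (1 + lform l \<alpha>) *s axis j 1"
      by (simp add: M_def y_def mat_1_nth vec_eq_iff axis_def)
    with True show ?thesis
      by (simp add: vec_mult_pseudoreflection vector_matrix_left_distrib scalar_vector_matrix_assoc
          axis_vec_mult L_def)
  next
    case False
    then have "M $ i = axis i 1 + \<alpha> $ i *s axis j 1"
      by (simp add: M_def y_def mat_1_nth vec_eq_iff axis_def)
    with False show ?thesis
      by (simp add: vec_mult_pseudoreflection vector_matrix_left_distrib scalar_vector_matrix_assoc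
          axis_vec_mult L_def mat_1_nth) (simp add: lform_commute[of _ \<alpha>] lform_axis)
  qed
  then have "L ** pseudoreflection l \<alpha> = M ** L"
    by (simp add: vec_eq_iff vector_matrix_mult_def matrix_matrix_mult_def)
  then have "det L * det (pseudoreflection l \<alpha>) = det M * det L"
    by (metis det_mul)
  with j show ?thesis
    by (simp add: det_L det_M)
qed

lemma pseudoreflection_eigenvector: "pseudoreflection l \<alpha> *v \<alpha> = det (pseudoreflection l \<alpha>) *s \<alpha>"
  by (simp add: pseudoreflection_mult_vec det_pseudoreflection)

lemma
  assumes "invertible A"
  shows matrix_mult_matrix_inv: "A ** matrix_inv A = mat 1"
    and matrix_inv_matrix_mult: "matrix_inv A ** A = mat 1"
  using someI_ex[OF assms[unfolded invertible_def]] by (simp_all add: matrix_inv_def)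

lemma det_matrix_inv:
  fixes A :: "'a::field ^ 'n ^ 'n::finite"
  assumes "invertible A"
  shows "det (matrix_inv A) = inverse (det A)"
proof -
  have "det (matrix_inv A) * det A = 1"
    by (simp add: matrix_inv_matrix_mult[OF assms] flip: det_mul)
  then show ?thesis
    by (metis inverse_unique mult.commute)
qed

lemma matrix_inv_fixes:
  assumes "invertible A" "A *v v = v"
  shows "matrix_inv A *v v = v"
  by (metis assms matrix_inv_matrix_mult matrix_vector_mul_assoc matrix_vector_mul_lid)

lemma matrix_inv_pseudoreflection:
  assumes "l \<noteq> 0" "invertible (pseudoreflection l \<alpha>)"
  obtains \<beta> where "matrix_inv (pseudoreflection l \<alpha>) = pseudoreflection l \<beta>"
proof -
  have "matrix_inv (pseudoreflection l \<alpha>) *v v = v" if "lform l v = 0" for v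
    using that by (intro matrix_inv_fixes[OF assms(2)]) (simp add: pseudoreflection_mult_vec)
  then show ?thesis
    using that fixes_hyperplane_imp_pseudoreflection[OF assms(1)] by blast
qed

lemma linear_subst_pseudoreflection_lin_poly:
  "linear_subst (pseudoreflection l \<alpha>) (lin_poly l) = pconst (det (pseudoreflection l \<alpha>)) * lin_poly l"
  by (simp add: linear_subst_lin_poly vec_mult_pseudoreflection det_pseudoreflection lin_poly_add
      lin_poly_scale pconst.add distrib_right)

lemma dvd_linear_subst_pseudoreflection_diff:
  "lin_poly l dvd linear_subst (pseudoreflection l \<alpha>) p - p"
  unfolding linear_subst_def
  by (intro dvd_psubst_diff) (simp add: pseudoreflection_def lin_poly_add lin_poly_scale lin_poly_axis)

text \<open>For \<open>l(u) = 1\<close>, \<open>pseudoreflection l (- u)\<close> is the projection onto the kernel of \<open>l\<close> along \<open>u\<close>.\<close>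

lemma lin_poly_dvd_iff:
  assumes "lform l u = 1"
  shows "lin_poly l dvd p \<longleftrightarrow> linear_subst (pseudoreflection l (- u)) p = 0"
proof
  have "linear_subst (pseudoreflection l (- u)) (lin_poly l) = 0"
    using assms by (simp add: linear_subst_pseudoreflection_lin_poly det_pseudoreflection lform.neg)
  moreover assume "lin_poly l dvd p"
  then obtain q where "p = lin_poly l * q" ..
  ultimately show "linear_subst (pseudoreflection l (- u)) p = 0"
    by (simp add: linear_subst.mult)
next
  assume "linear_subst (pseudoreflection l (- u)) p = 0"
  then show "lin_poly l dvd p"
    using dvd_linear_subst_pseudoreflection_diff[of l "- u" p] by simp
qed

lemma prime_elem_lin_poly:
  assumes "l \<noteq> 0"
  shows "prime_elem (lin_poly l)"
proof -
  obtain u where u: "lform l u = 1"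
    using assms by (rule ex_lform_eq_1)
  show ?thesis
    using assms by (intro prime_elemI)
      (simp_all add: lin_poly_dvd_iff[OF u] linear_subst.mult linear_subst.one)
qed

lemma lin_poly_dvd_lin_poly_imp_kernel_eq:
  assumes "l \<noteq> 0" "m \<noteq> 0" "lin_poly l dvd lin_poly m"
  shows "{v. lform l v = 0} = {v. lform m v = 0}"
proof -
  obtain u where u: "lform l u = 1"
    using assms(1) by (rule ex_lform_eq_1)
  then have "m + lform m (- u) *s l = 0"
    using assms(3)
    by (simp add: lin_poly_dvd_iff[OF u] linear_subst_lin_poly vec_mult_pseudoreflection)
  then have "m = lform m u *s l"
    by (simp only: lform.neg vector_smult_lneg add_uminus_conv_diff right_minus_eq)
  then obtain x where m: "m = x *s l" ..
  have "lform m v = x * lform l v" for v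
    using lform.scale[of v x l] by (simp only: m lform_commute[of _ v])
  moreover have "x \<noteq> 0"
    using assms(2) m by auto
  ultimately show ?thesis
    by simp
qed

lemma mpow_0 [simp]: "mpow g 0 = mat 1"
  and mpow_Suc: "mpow g (Suc k) = g ** mpow g k"
  by (simp_all add: mpow_def)

lemma det_mpow: "det (mpow g k) = det g ^ k"
  by (induction k) (simp_all add: mpow_Suc det_mul)

lemma mpow_pseudoreflection:
  "mpow (pseudoreflection l \<alpha>) k = pseudoreflection l ((\<Sum>i<k. (1 + lform l \<alpha>) ^ i) *s \<alpha>)"
proof (induction k)
  case (Suc k)
  let ?q = "1 + lform l \<alpha>" and ?S = "\<lambda>k. \<Sum>i<k. (1 + lform l \<alpha>) ^ i"
  have "?S (Suc k) = ?S k + (1 + lform l (?S k *s \<alpha>))"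
    by (simp add: sum.lessThan_Suc_shift lform.scale distrib_right sum.distrib sum_distrib_left
        mult.commute del: sum.lessThan_Suc)
  then show ?case
    by (simp only: mpow_Suc Suc pseudoreflection_mult flip: vector_sadd_rdistrib)
qed simp

lemma mpow_pseudoreflection_eq_1_iff:
  assumes "lform l \<alpha> \<noteq> 0"
  shows "mpow (pseudoreflection l \<alpha>) k = mat 1 \<longleftrightarrow> det (pseudoreflection l \<alpha>) ^ k = 1"
proof
  assume "det (pseudoreflection l \<alpha>) ^ k = 1"
  then have "lform l \<alpha> * (\<Sum>i<k. (1 + lform l \<alpha>) ^ i) = 0"
    using power_diff_1_eq[of "1 + lform l \<alpha>" k] by (simp add: det_pseudoreflection)
  with assms show "mpow (pseudoreflection l \<alpha>) k = mat 1"
    by (simp add: mpow_pseudoreflection)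
qed (metis det_I det_mpow)

lemma
  assumes "l \<noteq> 0" "invertible (pseudoreflection l \<alpha>)"
  shows dvd_act_pseudoreflection_diff: "lin_poly l dvd act (pseudoreflection l \<alpha>) p - p"
    and act_pseudoreflection_lin_poly: "act (pseudoreflection l \<alpha>) (lin_poly l)
      = pconst (inverse (det (pseudoreflection l \<alpha>))) * lin_poly l"
proof -
  obtain \<beta> where \<beta>: "matrix_inv (pseudoreflection l \<alpha>) = pseudoreflection l \<beta>"
    using assms by (rule matrix_inv_pseudoreflection)
  show "lin_poly l dvd act (pseudoreflection l \<alpha>) p - p"
    unfolding act_eq_linear_subst \<beta> by (rule dvd_linear_subst_pseudoreflection_diff)
  show "act (pseudoreflection l \<alpha>) (lin_poly l)
      = pconst (inverse (det (pseudoreflection l \<alpha>))) * lin_poly l"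
    unfolding act_eq_linear_subst det_matrix_inv[OF assms(2), symmetric] \<beta>
    by (rule linear_subst_pseudoreflection_lin_poly)
qed

lemma lin_poly_power_dvd_semi_invariant:
  assumes "l \<noteq> 0" "g = pseudoreflection l \<alpha>" "invertible g" and \<nu>: "\<nu> = inverse (det g)"
    and "act g f = pconst (\<nu> ^ a) * f" "\<And>b. b < a \<Longrightarrow> \<nu> ^ b \<noteq> \<nu> ^ a"
  shows "lin_poly l ^ a dvd f"
  using assms(5,6)
proof (induction a arbitrary: f)
  case (Suc a)
  have \<nu>_nz: "\<nu> \<noteq> 0"
    using assms(3) by (simp add: \<nu> invertible_det_nz)
  have "lin_poly l dvd act g f - f"
    using dvd_act_pseudoreflection_diff assms(1-3) by blast
  also have "act g f - f = pconst (\<nu> ^ Suc a - 1) * f"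
    by (simp only: Suc.prems(1) pconst.diff pconst.one left_diff_distrib mult_1)
  finally have "lin_poly l dvd f"
    using Suc.prems(2)[of 0] by (subst (asm) dvd_pconst_mult_iff) auto
  then obtain f' where f: "f = lin_poly l * f'" ..
  have "act g (lin_poly l) = pconst \<nu> * lin_poly l"
    using act_pseudoreflection_lin_poly assms(1-3) by (auto simp: \<nu>)
  then have "(pconst \<nu> * lin_poly l) * act g f' = (pconst \<nu> * lin_poly l) * (pconst (\<nu> ^ a) * f')"
    using Suc.prems(1) by (simp add: f act.mult pconst.mult mult_ac)
  then have "act g f' = pconst (\<nu> ^ a) * f'"
    using \<nu>_nz assms(1) by (simp add: mpoly_mult_cancel_left)
  moreover have "\<nu> ^ b \<noteq> \<nu> ^ a" if "b < a" for b
    using Suc.prems(2)[of "Suc b"] that by auto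
  ultimately have "lin_poly l ^ a dvd f'"
    by (rule Suc.IH)
  then show ?case
    by (simp add: f mult_dvd_mono)
qed simp

subsection \<open>Differential forms\<close>

definition contract :: "('a::field, 'n::finite) form1 \<Rightarrow> 'a ^ 'n \<Rightarrow> ('a, 'n) mpoly" where
  "contract \<eta> v = (\<Sum>i\<in>UNIV. \<eta> i * pconst (v $ i))"

lemma contract_add: "contract \<eta> (u + v) = contract \<eta> u + contract \<eta> v"
  by (simp add: contract_def pconst.add distrib_left sum.distrib)

lemma contract_scale: "contract \<eta> (x *s v) = pconst x * contract \<eta> v"
  by (simp add: contract_def pconst.mult sum_distrib_left mult_ac)

lemma contract_act_form:
  "contract (act_form g \<eta>) v = act g (contract \<eta> (matrix_inv g *v v))"
proof -
  let ?B = "matrix_inv g"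
  have "contract (act_form g \<eta>) v
      = (\<Sum>j\<in>UNIV. \<Sum>i\<in>UNIV. act g (\<eta> i) * pconst (?B $ i $ j) * pconst (v $ j))"
    by (simp add: contract_def act_form_def sum_distrib_right)
  also have "\<dots> = (\<Sum>i\<in>UNIV. \<Sum>j\<in>UNIV. act g (\<eta> i) * pconst (?B $ i $ j) * pconst (v $ j))"
    by (rule sum.swap)
  also have "\<dots> = act g (contract \<eta> (?B *v v))"
    by (simp add: contract_def matrix_vector_mult_def act.sum act.mult pconst.sum pconst.mult
        sum_distrib_left mult.assoc)
  finally show ?thesis .
qed

lemma chi_forms_contract:
  assumes "\<eta> \<in> chi_forms G chi" "g \<in> G" "invertible g"
  shows "act g (contract \<eta> v) = pconst (chi g) * contract \<eta> (g *v v)"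
proof -
  have "act_form g \<eta> = (\<lambda>j. pconst (chi g) * \<eta> j)"
    using assms(1,2) by (simp add: chi_forms_def)
  then have "contract (act_form g \<eta>) (g *v v) = pconst (chi g) * contract \<eta> (g *v v)"
    by (simp add: contract_def sum_distrib_left mult.assoc)
  then show ?thesis
    by (simp add: contract_act_form matrix_vector_mul_assoc matrix_inv_matrix_mult assms(3))
qed

lemma det_contract:
  "det (\<chi> k j. contract (\<eta> k) (v j)) = top_wedge \<eta> * pconst (det (\<chi> i j. v j $ i))"
proof -
  have "(\<chi> k j. contract (\<eta> k) (v j)) = (\<chi> k j. \<eta> k j) ** (\<chi> i j. pconst ((\<chi> i j. v j $ i) $ i $ j))"
    by (simp add: matrix_matrix_mult_def contract_def)
  then show ?thesis
    by (simp only: det_mul pconst.det top_wedge_def)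
qed

lemma top_wedge_act_form:
  "top_wedge (\<lambda>k. act_form g (\<theta> k)) = act g (top_wedge \<theta>) * pconst (det (matrix_inv g))"
proof -
  have "(\<chi> k j. act_form g (\<theta> k) j)
      = (\<chi> k j. act g ((\<chi> k j. \<theta> k j) $ k $ j)) ** (\<chi> i j. pconst (matrix_inv g $ i $ j))"
    by (simp add: matrix_matrix_mult_def act_form_def)
  then show ?thesis
    by (simp only: top_wedge_def det_mul act.det pconst.det)
qed

lemma top_wedge_scale: "top_wedge (\<lambda>k j. x * \<theta> k j) = x ^ CARD('n) * top_wedge \<theta>"
  for \<theta> :: "'n::finite \<Rightarrow> ('a::field, 'n) form1"
  using det_rows_mul[of "\<lambda>_. x" "\<lambda>k. \<chi> j. \<theta> k j"]
  by (simp add: top_wedge_def vector_scalar_mult_def)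

lemma top_wedge_chi_forms:
  fixes \<theta> :: "'n::finite \<Rightarrow> ('a::field, 'n) form1"
  assumes "\<And>k. \<theta> k \<in> chi_forms G chi" "g \<in> G"
  shows "act g (top_wedge \<theta>) * pconst (det (matrix_inv g)) = pconst (chi g ^ CARD('n)) * top_wedge \<theta>"
proof -
  have "act_form g (\<theta> k) = (\<lambda>j. pconst (chi g) * \<theta> k j)" for k
    using assms by (simp add: chi_forms_def)
  then show ?thesis
    by (simp add: top_wedge_scale pconst.power flip: top_wedge_act_form)
qed

subsection \<open>Cramer's rule for forms\<close>

lemma top_wedge_fun_upd:
  "top_wedge (\<theta>(k := \<eta>)) = ((\<chi> j. \<eta> j) v* adjugate (\<chi> k j. \<theta> k j)) $ k"
proof -
  have "(\<chi> i j. (\<theta>(k := \<eta>)) i j) = (\<chi> i. if i = k then (\<chi> j. \<eta> j) else (\<chi> i j. \<theta> i j) $ i)"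
    by (simp add: vec_eq_iff)
  then show ?thesis
    by (simp only: top_wedge_def det_replace_row)
qed

lemma cramer_form:
  "top_wedge \<theta> * \<eta> j = (\<Sum>k\<in>UNIV. top_wedge (\<theta>(k := \<eta>)) * \<theta> k j)"
proof -
  let ?A = "\<chi> k j. \<theta> k j" and ?y = "\<chi> j. \<eta> j"
  have "(?y v* adjugate ?A) v* ?A = top_wedge \<theta> *s ?y"
    by (simp only: vector_matrix_mul_assoc adjugate_matrix_mult vector_matrix_mult_mat top_wedge_def)
  then show ?thesis
    by (simp add: top_wedge_fun_upd vector_matrix_mult_def[of _ ?A] vec_eq_iff)
qed

lemma cramer_form_coeff:
  "top_wedge (\<theta>(k := \<lambda>j. \<Sum>i\<in>UNIV. f i * \<theta> i j)) = top_wedge \<theta> * f k"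
proof -
  let ?A = "\<chi> k j. \<theta> k j" and ?f = "\<chi> i. f i"
  have "(\<chi> j. \<Sum>i\<in>UNIV. f i * \<theta> i j) = ?f v* ?A"
    by (simp add: vector_matrix_mult_def)
  then have "top_wedge (\<theta>(k := \<lambda>j. \<Sum>i\<in>UNIV. f i * \<theta> i j)) = ((?f v* ?A) v* adjugate ?A) $ k"
    by (simp only: top_wedge_fun_upd)
  then show ?thesis
    by (simp only: vector_matrix_mul_assoc matrix_mult_adjugate vector_matrix_mult_mat top_wedge_def)
      simp
qed

subsection \<open>Bases adapted to a hyperplane\<close>

lemma card_basis:
  fixes C :: "('a::field ^ 'n::finite) set"
  assumes "vec.independent C" "vec.span C = UNIV"
  shows "card C = CARD('n)"
  using assms vec.dim_eq_card[of C UNIV] by (simp add: card_cart_basis)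

lemma power_dvd_top_wedge_of_basis:
  fixes \<eta> :: "'n::finite \<Rightarrow> ('a::field, 'n) form1"
  assumes basis: "vec.independent C" "vec.span C = UNIV"
    and dvd: "\<And>i v. v \<in> C \<Longrightarrow> p ^ k v dvd contract (\<eta> i) v"
  shows "p ^ (\<Sum>v\<in>C. k v) dvd top_wedge \<eta>"
proof -
  obtain v :: "'n \<Rightarrow> 'a ^ 'n" where v: "bij_betw v UNIV C"
    using finite_same_card_bij[OF finite vec.finiteI_independent[OF basis(1)]] card_basis[OF basis]
    by metis
  have "columns (\<chi> i j. v j $ i) = C"
    using v by (auto simp: columns_def column_def bij_betw_def)
  then have "det (\<chi> i j. v j $ i) \<noteq> 0"
    using basis(2) matrix_right_invertible_span_columns[of "\<chi> i j. v j $ i"]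
    by (simp add: invertible_right_inverse flip: invertible_det_nz)
  moreover have "p ^ (\<Sum>j\<in>UNIV. k (v j)) dvd det (\<chi> i j. contract (\<eta> i) (v j))"
    using v by (intro power_dvd_det_of_columns) (auto simp: bij_betw_def intro: dvd)
  ultimately have "p ^ (\<Sum>j\<in>UNIV. k (v j)) dvd top_wedge \<eta>"
    by (simp add: det_contract mult.commute[of "top_wedge \<eta>"] dvd_pconst_mult_iff)
  then show ?thesis
    by (simp add: sum.reindex_bij_betw[OF v])
qed

lemma hyperplane_adapted_basis:
  fixes l :: "'a::field ^ 'n::finite"
  assumes B: "vec.independent B" "B \<subseteq> {v. lform l v = 0}" and \<alpha>: "lform l \<alpha> \<noteq> 0"
  obtains C where "B \<subseteq> C" "C \<subseteq> {v. lform l v = 0}"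
    "vec.independent (insert \<alpha> C)" "vec.span (insert \<alpha> C) = UNIV"
proof -
  let ?H = "{v. lform l v = 0}"
  obtain C where C: "B \<subseteq> C" "C \<subseteq> ?H" "vec.independent C" "?H \<subseteq> vec.span C"
    by (rule vec.maximal_independent_subset_extend[OF B(2,1)])
  have "vec.span C \<subseteq> ?H"
    using C(2) lform.subspace_kernel by (rule vec.span_minimal)
  then have "\<alpha> \<notin> vec.span C"
    using \<alpha> by auto
  then have "vec.independent (insert \<alpha> C)"
    using C(3) by (rule vec.independent_insertI)
  moreover have "x \<in> vec.span (insert \<alpha> C)" for x
  proof -
    have "x - (lform l x / lform l \<alpha>) *s \<alpha> \<in> ?H"
      using \<alpha> by (simp add: lform.diff lform.scale)
    then show ?thesis
      using C(4) unfolding vec.span_insert by blast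
  qed
  ultimately show ?thesis
    using that C(1,2) by blast
qed

subsection \<open>Roots of unity in a field\<close>

definition primitive_root_of_unity :: "nat \<Rightarrow> 'a::field \<Rightarrow> bool" where
  "primitive_root_of_unity n x \<longleftrightarrow> n > 0 \<and> (\<forall>k. x ^ k = 1 \<longleftrightarrow> n dvd k)"

lemma primitive_root_of_unityI:
  assumes "n > 0" "x ^ n = 1" "\<And>k. 0 < k \<Longrightarrow> k < n \<Longrightarrow> x ^ k \<noteq> 1"
  shows "primitive_root_of_unity n x"
proof -
  have power_mod: "x ^ k = x ^ (k mod n)" for k
    using assms(2) by (metis mult_1 power_add power_mult power_one mult_div_mod_eq)
  have "x ^ k = 1 \<longleftrightarrow> k mod n = 0" for k
    using assms(1) assms(3)[of "k mod n"] by (cases "k mod n = 0") (simp_all add: power_mod[of k])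
  then show ?thesis
    using assms(1) by (simp add: primitive_root_of_unity_def dvd_eq_mod_eq_0)
qed

lemma primitive_root_of_unity_power:
  "primitive_root_of_unity (m * n) x \<Longrightarrow> primitive_root_of_unity n (x ^ m)"
  by (auto simp: primitive_root_of_unity_def simp flip: power_mult)

lemma primitive_root_of_unity_mult:
  assumes "primitive_root_of_unity m x" "primitive_root_of_unity n y" "coprime m n"
  shows "primitive_root_of_unity (m * n) (x * y)"
proof -
  have order_dvd: "m dvd k"
    if "primitive_root_of_unity m x" "primitive_root_of_unity n y" "coprime m n" "(x * y) ^ k = 1"
    for m n k and x y :: 'a
  proof -
    have "(x * y) ^ (k * n) = 1" "y ^ (k * n) = 1"
      using that(2,4) by (simp_all add: power_mult[of "x * y"] primitive_root_of_unity_def)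
    then have "x ^ (k * n) = 1"
      by (simp add: power_mult_distrib)
    then show ?thesis
      using that by (simp add: primitive_root_of_unity_def coprime_dvd_mult_left_iff)
  qed
  have "(x * y) ^ k = 1 \<longleftrightarrow> m * n dvd k" for k
  proof
    assume "(x * y) ^ k = 1"
    then have "m dvd k" "n dvd k"
      using order_dvd[OF assms] order_dvd[of n y m x k] assms
      by (simp_all add: coprime_commute mult.commute)
    then show "m * n dvd k"
      using assms(3) by (rule divides_mult)
  next
    assume "m * n dvd k"
    then have "m dvd k" "n dvd k"
      by (auto dest: dvd_mult_left dvd_mult_right)
    then have "x ^ k = 1" "y ^ k = 1"
      using assms(1,2) by (simp_all add: primitive_root_of_unity_def)
    then show "(x * y) ^ k = 1"
      by (simp add: power_mult_distrib)
  qed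
  then show ?thesis
    using assms(1,2) by (simp add: primitive_root_of_unity_def)
qed

lemma inj_on_primitive_root_of_unity_power:
  assumes "primitive_root_of_unity n x"
  shows "inj_on (\<lambda>k. x ^ k) {..<n}"
proof -
  have "x \<noteq> 0"
    using assms by (metis primitive_root_of_unity_def dvd_refl power_0_left zero_neq_one less_irrefl)
  have "i = j" if "i \<le> j" "j < n" "x ^ i = x ^ j" for i j
  proof -
    have "x ^ (j - i) = 1"
      using that(1,3) \<open>x \<noteq> 0\<close> by (simp add: power_diff)
    then have "n dvd j - i"
      using assms by (simp add: primitive_root_of_unity_def)
    then show ?thesis
      using that(1,2) by (auto dest: dvd_imp_le)
  qed
  then show ?thesis
    unfolding inj_on_def by (metis lessThan_iff nle_le)
qed

lemma
  assumes "n > 0"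
  shows finite_roots_of_unity: "finite {x::'a::field. x ^ n = 1}"
    and card_roots_of_unity_le: "card {x::'a::field. x ^ n = 1} \<le> n"
proof -
  let ?p = "monom (1::'a) n + - 1"
  have deg: "degree ?p = n"
    using assms by (subst degree_add_eq_left) (auto simp: degree_monom_eq)
  then have "?p \<noteq> 0"
    using assms by auto
  moreover have "{x. x ^ n = 1} = {x. poly ?p x = 0}"
    by (simp add: poly_monom)
  ultimately show "finite {x::'a. x ^ n = 1}" "card {x::'a. x ^ n = 1} \<le> n"
    using poly_roots_finite[of ?p] card_poly_roots_bound[of ?p] deg by auto
qed

lemma primitive_root_of_unity_powers:
  assumes "primitive_root_of_unity n \<mu>"
  shows "{x. x ^ n = 1} = (\<lambda>k. \<mu> ^ k) ` {..<n}"
proof (rule card_seteq[symmetric])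
  have n: "n > 0" "\<mu> ^ n = 1"
    using assms by (simp_all add: primitive_root_of_unity_def)
  show "finite {x::'a. x ^ n = 1}"
    using n(1) by (rule finite_roots_of_unity)
  show "(\<lambda>k. \<mu> ^ k) ` {..<n} \<subseteq> {x. x ^ n = 1}"
  proof safe
    fix k
    have "(\<mu> ^ k) ^ n = (\<mu> ^ n) ^ k"
      by (simp add: mult.commute flip: power_mult)
    then show "(\<mu> ^ k) ^ n = 1"
      by (simp add: n(2))
  qed
  show "card {x::'a. x ^ n = 1} \<le> card ((\<lambda>k. \<mu> ^ k) ` {..<n})"
    using card_roots_of_unity_le[OF n(1)] inj_on_primitive_root_of_unity_power[OF assms]
    by (simp add: card_image)
qed

lemma ex_repeated_value:
  fixes f :: "nat \<Rightarrow> 'b"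
  assumes "finite A" "\<And>k. f k \<in> A"
  obtains i j where "i < j" "f i = f j"
proof -
  have "\<not> inj f"
    using assms finite_subset[of "range f" A] range_inj_infinite by blast
  then show ?thesis
    using that linorder_injI[of f] by blast
qed

locale finite_mult_subgroup =
  fixes A :: "'a::field set"
  assumes finite: "finite A" and one_mem: "1 \<in> A" and zero_not_mem: "0 \<notin> A"
    and mult_mem: "x \<in> A \<Longrightarrow> y \<in> A \<Longrightarrow> x * y \<in> A"
begin

lemma power_mem: "x \<in> A \<Longrightarrow> x ^ k \<in> A"
  by (induction k) (simp_all add: one_mem mult_mem)

lemma ex_primitive_root_of_unity:
  assumes "x \<in> A"
  obtains n where "primitive_root_of_unity n x"
proof -
  obtain i j where ij: "i < j" "x ^ i = x ^ j"
    using finite power_mem[OF assms] by (rule ex_repeated_value)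
  have "x \<noteq> 0"
    using assms zero_not_mem by blast
  then have ex: "j - i > 0 \<and> x ^ (j - i) = 1"
    using ij by (simp add: power_diff)
  define n where "n = (LEAST n. n > 0 \<and> x ^ n = 1)"
  have "n > 0 \<and> x ^ n = 1"
    unfolding n_def using ex by (rule LeastI)
  moreover have "x ^ k \<noteq> 1" if "0 < k" "k < n" for k
    using not_less_Least[of k "\<lambda>n. n > 0 \<and> x ^ n = 1"] that by (auto simp: n_def)
  ultimately show ?thesis
    using that primitive_root_of_unityI by blast
qed

text \<open>If some order failed to divide the maximal order \<open>m\<close>, then at a prime \<open>p\<close> witnessing this the
  \<open>p\<close>-part of the former times the prime-to-\<open>p\<close> part of \<open>m\<close> would be a larger order.\<close>

lemma order_dvd_maximal_order:
  assumes \<mu>: "\<mu> \<in> A" "primitive_root_of_unity m \<mu>"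
    and max: "\<And>x n. x \<in> A \<Longrightarrow> primitive_root_of_unity n x \<Longrightarrow> n \<le> m"
    and x: "x \<in> A" "primitive_root_of_unity n x"
  shows "n dvd m"
proof (rule multiplicity_le_imp_dvd)
  have pos: "m > 0" "n > 0"
    using \<mu>(2) x(2) by (simp_all add: primitive_root_of_unity_def)
  then show "n \<noteq> 0"
    by simp
  fix p :: nat assume p: "prime p"
  let ?a = "multiplicity p n" and ?b = "multiplicity p m"
  obtain n' where n': "n = p ^ ?a * n'"
    using multiplicity_decompose'[of n p] pos(2) p by (metis not_gr_zero not_prime_unit)
  obtain m' where m': "m = p ^ ?b * m'" "\<not> p dvd m'"
    using multiplicity_decompose'[of m p] pos(1) p by (metis not_gr_zero not_prime_unit)
  have "primitive_root_of_unity (p ^ ?a) (x ^ n')"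
    using x(2) n' by (intro primitive_root_of_unity_power) (simp add: mult.commute)
  moreover have "primitive_root_of_unity m' (\<mu> ^ (p ^ ?b))"
    using \<mu>(2) m' by (intro primitive_root_of_unity_power) simp
  moreover have "coprime (p ^ ?a) m'"
    using p m'(2) by (simp add: prime_imp_coprime)
  ultimately have "primitive_root_of_unity (p ^ ?a * m') (x ^ n' * \<mu> ^ (p ^ ?b))"
    by (rule primitive_root_of_unity_mult)
  then have "p ^ ?a * m' \<le> p ^ ?b * m'"
    using max x(1) \<mu>(1) m'(1) by (metis mult_mem power_mem)
  then have "p ^ ?a \<le> p ^ ?b"
    using m'(2) by auto
  then show "?a \<le> ?b"
    using prime_gt_1_nat[OF p] by (simp only: power_increasing_iff)
qed

lemma ex_generator:
  obtains \<mu> where "\<mu> \<in> A" "primitive_root_of_unity (card A) \<mu>"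
proof -
  define orders where "orders = {n. \<exists>x\<in>A. primitive_root_of_unity n x}"
  have bound: "n \<le> card A" if "x \<in> A" "primitive_root_of_unity n x" for x n
  proof -
    have "(\<lambda>k. x ^ k) ` {..<n} \<subseteq> A"
      using that(1) by (auto simp: power_mem)
    then show ?thesis
      using inj_on_primitive_root_of_unity_power[OF that(2)] card_inj_on_le[OF _ _ finite]
      by fastforce
  qed
  define m where "m = Max orders"
  have "finite orders"
    using bound by (intro finite_subset[of orders "{..card A}"]) (auto simp: orders_def)
  moreover have "orders \<noteq> {}"
    using one_mem ex_primitive_root_of_unity[OF one_mem] unfolding orders_def by blast
  ultimately have "m \<in> orders" and max: "\<And>n. n \<in> orders \<Longrightarrow> n \<le> m"
    by (simp_all add: m_def)
  from this(1) obtain \<mu> where \<mu>: "\<mu> \<in> A" "primitive_root_of_unity m \<mu>"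
    by (auto simp: orders_def)
  have "x ^ m = 1" if x: "x \<in> A" for x
  proof -
    obtain n where "primitive_root_of_unity n x"
      using x by (rule ex_primitive_root_of_unity)
    moreover from this have "n dvd m"
      using order_dvd_maximal_order[OF \<mu> _ x] max by (auto simp: orders_def)
    ultimately show ?thesis
      by (simp add: primitive_root_of_unity_def)
  qed
  moreover have "m > 0"
    using \<mu>(2) by (simp add: primitive_root_of_unity_def)
  ultimately have "card A \<le> m"
    using card_mono[OF finite_roots_of_unity, of m A] card_roots_of_unity_le[of m, where ?'a = 'a]
    by fastforce
  with bound[OF \<mu>] \<mu> show ?thesis
    using that by (metis le_antisym)
qed

lemma eq_powers_of_generator:
  assumes "\<mu> \<in> A" "primitive_root_of_unity (card A) \<mu>"
  shows "A = (\<lambda>k. \<mu> ^ k) ` {..<card A}"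
  using inj_on_primitive_root_of_unity_power[OF assms(2)]
  by (intro card_subset_eq[symmetric] finite) (auto simp: card_image power_mem assms(1))

end

lemma power_CHAR_eq_1_iff:
  fixes x :: "'a::field"
  assumes "CHAR('a) > 0"
  shows "x ^ CHAR('a) = 1 \<longleftrightarrow> x = 1"
proof
  have p: "prime CHAR('a)"
    using assms by (rule prime_CHAR_semidom)
  assume "x ^ CHAR('a) = 1"
  then have "(x - 1) ^ CHAR('a) = 0"
    using freshmans_dream[OF p refl, of "x - 1" 1] by simp
  then show "x = 1"
    by simp
qed simp

subsection \<open>Finite matrix groups and their linear characters\<close>

locale finite_matrix_group =
  fixes G :: "('a::field ^ 'n ^ 'n::finite) set"
  assumes matrix_group: "matrix_group G"
begin

lemma finite: "finite G"
  and one_mem: "mat 1 \<in> G"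
  and mult_mem: "g \<in> G \<Longrightarrow> h \<in> G \<Longrightarrow> g ** h \<in> G"
  and invertible: "g \<in> G \<Longrightarrow> invertible g"
  and matrix_inv_mem: "g \<in> G \<Longrightarrow> matrix_inv g \<in> G"
  using matrix_group by (simp_all add: matrix_group_def)

lemma mpow_mem: "g \<in> G \<Longrightarrow> mpow g k \<in> G"
  by (induction k) (simp_all add: mpow_Suc one_mem mult_mem)

lemma mgen_subset:
  assumes "S \<subseteq> G"
  shows "mgen S \<subseteq> G"
proof
  fix x assume "x \<in> mgen S"
  then show "x \<in> G"
    using assms by induction (auto simp: one_mem mult_mem)
qed

text \<open>The powers of a transvection with root \<open>\<beta>\<close> have the roots \<open>k \<beta>\<close>, of which only finitely many
  can be distinct.\<close>

lemma transvection_imp_CHAR_pos: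
  assumes "pseudoreflection l \<beta> \<in> G" "lform l \<beta> = 0" "l \<noteq> 0" "\<beta> \<noteq> 0"
  shows "CHAR('a) > 0"
proof -
  let ?t = "pseudoreflection l \<beta>"
  obtain i j where "i < j" "mpow ?t i = mpow ?t j"
    using finite mpow_mem[OF assms(1)] by (rule ex_repeated_value)
  then have "of_nat i = (of_nat j :: 'a)"
    using assms(2-4) by (simp add: mpow_pseudoreflection pseudoreflection_eq_iff)
  then have "of_nat (j - i) = (0::'a)"
    using \<open>i < j\<close> by simp
  then show ?thesis
    using \<open>i < j\<close> by (metis CHAR_pos_iff zero_less_diff)
qed

end

lemma mgen_mpow_mult: "s \<in> S \<Longrightarrow> x \<in> mgen S \<Longrightarrow> mpow s k ** x \<in> mgen S"
  by (induction k) (auto simp: mpow_Suc intro: mgen_mult simp flip: matrix_mul_assoc)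

locale linear_character = finite_matrix_group G
  for G :: "('a::field ^ 'n ^ 'n::finite) set" +
  fixes chi :: "'a ^ 'n ^ 'n \<Rightarrow> 'a"
  assumes lin_char: "lin_char G chi"
begin

lemma nonzero: "g \<in> G \<Longrightarrow> chi g \<noteq> 0"
  and mult: "g \<in> G \<Longrightarrow> h \<in> G \<Longrightarrow> chi (g ** h) = chi g * chi h"
  using lin_char by (simp_all add: lin_char_def)

lemma one: "chi (mat 1) = 1"
  using mult[OF one_mem one_mem] nonzero[OF one_mem] by simp

lemma mpow: "g \<in> G \<Longrightarrow> chi (mpow g k) = chi g ^ k"
  by (induction k) (simp_all add: mpow_Suc one mult mpow_mem)

lemma matrix_inv_mult: "g \<in> G \<Longrightarrow> chi (matrix_inv g) * chi g = 1"
  using mult[OF matrix_inv_mem, of g g] by (simp add: matrix_inv_matrix_mult invertible one)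

sublocale image: finite_mult_subgroup "chi ` G"
proof
  show "1 \<in> chi ` G"
    using one one_mem by (metis imageI)
  show "x * y \<in> chi ` G" if "x \<in> chi ` G" "y \<in> chi ` G" for x y
    using that by (auto simp: mult_mem simp flip: mult)
qed (auto simp: finite nonzero)

lemma card_eq_card_image_mult_card_kernel:
  "card G = card (chi ` G) * card {g \<in> G. chi g = 1}"
proof -
  let ?K = "{g \<in> G. chi g = 1}"
  have "card {h \<in> G. chi h = chi g} = card ?K" if g: "g \<in> G" for g
  proof -
    note g_inv = matrix_mult_matrix_inv[OF invertible[OF g]]
      matrix_inv_matrix_mult[OF invertible[OF g]]
    have "bij_betw ((**) g) ?K {h \<in> G. chi h = chi g}"
    proof (rule bij_betw_byWitness[of _ "(**) (matrix_inv g)"])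
      show "(**) g ` ?K \<subseteq> {h \<in> G. chi h = chi g}"
        using g by (auto simp: mult mult_mem)
      show "(**) (matrix_inv g) ` {h \<in> G. chi h = chi g} \<subseteq> ?K"
        using g by (auto simp: mult mult_mem matrix_inv_mem matrix_inv_mult)
    qed (auto simp: matrix_mul_assoc g_inv)
    then show ?thesis
      by (simp add: bij_betw_same_card)
  qed
  then have "(\<Sum>x\<in>chi ` G. card {h \<in> G. chi h = x}) = (\<Sum>x\<in>chi ` G. card ?K)"
    by (intro sum.cong) auto
  then show ?thesis
    using sum.group[of G "chi ` G" chi "\<lambda>_. 1::nat"] finite by simp
qed

lemma eq_mgen_insert_kernel:
  assumes s: "s \<in> G" "primitive_root_of_unity (card (chi ` G)) (chi s)"
  shows "G = mgen (insert s {g \<in> G. chi g = 1})"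
proof
  show "mgen (insert s {g \<in> G. chi g = 1}) \<subseteq> G"
    using s(1) by (intro mgen_subset) auto
  show "G \<subseteq> mgen (insert s {g \<in> G. chi g = 1})"
  proof
    fix g assume g: "g \<in> G"
    then obtain k where k: "chi g = chi s ^ k"
      using image.eq_powers_of_generator[OF _ s(2)] s(1) by blast
    let ?t = "mpow s k"
    have t: "?t \<in> G"
      using s(1) by (rule mpow_mem)
    then have "matrix_inv ?t ** g \<in> {g \<in> G. chi g = 1}"
      using g matrix_inv_mult[OF t] by (simp add: mult mult_mem matrix_inv_mem mpow s(1) k)
    then have "(matrix_inv ?t ** g) ** mat 1 \<in> mgen (insert s {g \<in> G. chi g = 1})"
      by (intro mgen_mult mgen_one) blast
    then have "?t ** (matrix_inv ?t ** g) \<in> mgen (insert s {g \<in> G. chi g = 1})"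
      by (intro mgen_mpow_mult) auto
    then show "g \<in> mgen (insert s {g \<in> G. chi g = 1})"
      by (simp add: matrix_mul_assoc matrix_mult_matrix_inv invertible t)
  qed
qed

lemma transvection_eq_1:
  assumes t: "pseudoreflection l \<beta> \<in> G" and "lform l \<beta> = 0" "l \<noteq> 0"
  shows "chi (pseudoreflection l \<beta>) = 1"
proof (cases "\<beta> = 0")
  case False
  let ?t = "pseudoreflection l \<beta>"
  have "CHAR('a) > 0"
    using transvection_imp_CHAR_pos assms False by blast
  moreover have "chi ?t ^ CHAR('a) = 1"
    using mpow[OF t, of "CHAR('a)"] assms(2) by (simp add: mpow_pseudoreflection one)
  ultimately show ?thesis
    by (simp add: power_CHAR_eq_1_iff)
qed (simp add: one)

end

subsection \<open>The pointwise stabilizer of a hyperplane\<close>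

lemma has_order_iff_primitive_root_of_unity:
  assumes "\<And>k. mpow s k = mat 1 \<longleftrightarrow> x ^ k = 1"
  shows "has_order s e \<longleftrightarrow> primitive_root_of_unity e x"
proof
  assume "has_order s e"
  then show "primitive_root_of_unity e x"
    by (intro primitive_root_of_unityI) (simp_all add: has_order_def assms)
next
  assume "primitive_root_of_unity e x"
  then show "has_order s e"
    by (auto simp: has_order_def assms primitive_root_of_unity_def dest: dvd_imp_le)
qed

locale hyperplane_stabilizer = finite_matrix_group G
  for G :: "('a::field ^ 'n ^ 'n::finite) set" +
  fixes H :: "('a ^ 'n) set"
  assumes hyperplane: "is_hyperplane H"
begin

abbreviation "l\<^sub>H \<equiv> def_form H"
abbreviation "s\<^sub>H \<equiv> s_H G H"
abbreviation "e\<^sub>H \<equiv> e_H G H"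

lemma def_form_nonzero: "l\<^sub>H \<noteq> 0"
  and hyperplane_eq_kernel: "H = {v. lform l\<^sub>H v = 0}"
  using someI_ex[OF hyperplane[unfolded is_hyperplane_def]] by (simp_all add: def_form_def)

lemma pstab_imp_pseudoreflection:
  assumes "g \<in> pstab G H"
  obtains \<alpha> where "g = pseudoreflection l\<^sub>H \<alpha>"
  using fixes_hyperplane_imp_pseudoreflection[OF def_form_nonzero, of g] assms hyperplane_eq_kernel
  unfolding pstab_def by blast

lemma pstab_subset: "pstab G H \<subseteq> G"
  by (auto simp: pstab_def)

sublocale pstab: linear_character "pstab G H" det
proof
  show "matrix_group (pstab G H)"
    unfolding matrix_group_def
  proof (intro conjI ballI)
    show "finite (pstab G H)"
      using finite by (simp add: pstab_def)
  qed (auto simp: pstab_def one_mem mult_mem invertible matrix_inv_mem matrix_inv_fixes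
      simp flip: matrix_vector_mul_assoc)
  show "lin_char (pstab G H) det"
    using invertible by (simp add: lin_char_def pstab_def det_mul invertible_det_nz)
qed

lemma e_H_eq_card_det: "e\<^sub>H = card (det ` pstab G H)"
proof -
  have "card (K_H G H) > 0"
    using pstab.finite pstab.one_mem by (auto simp: K_H_def card_gt_0_iff)
  then show ?thesis
    using pstab.card_eq_card_image_mult_card_kernel by (simp add: e_H_def K_H_def)
qed

lemma
  assumes "\<rho> \<noteq> 0"
  defines "s \<equiv> pseudoreflection l\<^sub>H \<rho>"
  shows is_diag_reflection_iff: "is_diag_reflection s \<longleftrightarrow> is_reflection s \<and> lform l\<^sub>H \<rho> \<noteq> 0"
    and is_transvection_iff: "is_transvection s \<longleftrightarrow> is_reflection s \<and> lform l\<^sub>H \<rho> = 0"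
proof -
  have "fixspace s = H"
    using fixspace_pseudoreflection[OF assms(1)] hyperplane_eq_kernel by (simp add: s_def)
  moreover have "(\<forall>v. s *v v = v + lform l\<^sub>H v *s \<alpha>) \<longleftrightarrow> \<alpha> = \<rho>" for \<alpha>
    using pseudoreflection_eqI[of s l\<^sub>H \<alpha>] pseudoreflection_eq_iff[OF def_form_nonzero]
    by (auto simp: s_def pseudoreflection_mult_vec)
  ultimately show "is_diag_reflection s \<longleftrightarrow> is_reflection s \<and> lform l\<^sub>H \<rho> \<noteq> 0"
    and "is_transvection s \<longleftrightarrow> is_reflection s \<and> lform l\<^sub>H \<rho> = 0"
    by (simp_all add: is_diag_reflection_def is_transvection_def)
qed

lemma s_H_exists:
  "\<exists>s. s \<in> pstab G H \<and> has_order s e\<^sub>H \<and> pstab G H = mgen (insert s (K_H G H))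
      \<and> (if e\<^sub>H = 1 then s = mat 1 else is_diag_reflection s)"
proof (cases "e\<^sub>H = 1")
  case True
  then have primitive:
    "primitive_root_of_unity (card (det ` pstab G H)) (det (mat 1 :: 'a ^ 'n ^ 'n))"
    by (intro primitive_root_of_unityI) (simp_all flip: e_H_eq_card_det)
  have "has_order (mat 1 :: 'a ^ 'n ^ 'n) 1"
    by (auto simp: has_order_def mpow_Suc)
  then show ?thesis
    using True pstab.one_mem pstab.eq_mgen_insert_kernel[OF pstab.one_mem primitive]
    by (auto simp: K_H_def)
next
  case False
  obtain s where s: "s \<in> pstab G H" "primitive_root_of_unity e\<^sub>H (det s)"
    using pstab.image.ex_generator unfolding e_H_eq_card_det by blast
  obtain \<rho> where \<rho>: "s = pseudoreflection l\<^sub>H \<rho>"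
    using s(1) by (rule pstab_imp_pseudoreflection)
  have "det s \<noteq> 1"
    using s(2) False by (metis nat_dvd_1_iff_1 power_one_right primitive_root_of_unity_def)
  then have root: "lform l\<^sub>H \<rho> \<noteq> 0"
    by (simp add: \<rho> det_pseudoreflection)
  then have "\<rho> \<noteq> 0"
    by auto
  have order: "has_order s e\<^sub>H"
    using s(2) root has_order_iff_primitive_root_of_unity[of s "det s"]
    by (simp add: \<rho> mpow_pseudoreflection_eq_1_iff)
  have "is_reflection s"
    using fixspace_pseudoreflection[OF \<open>\<rho> \<noteq> 0\<close>] order hyperplane hyperplane_eq_kernel
      pstab.invertible[OF s(1)]
    by (auto simp: is_reflection_def has_order_def \<rho>)
  then have "is_diag_reflection s"
    using is_diag_reflection_iff[OF \<open>\<rho> \<noteq> 0\<close>] root by (simp add: \<rho>)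
  then show ?thesis
    using s order False pstab.eq_mgen_insert_kernel[of s] by (auto simp: K_H_def e_H_eq_card_det)
qed

lemma s_H_mem_pstab: "s\<^sub>H \<in> pstab G H"
    and s_H_has_order: "has_order s\<^sub>H e\<^sub>H"
    and s_H_cases: "if e\<^sub>H = 1 then s\<^sub>H = mat 1 else is_diag_reflection s\<^sub>H"
  using someI_ex[OF s_H_exists, folded s_H_def] by blast+

lemma s_H_mem: "s\<^sub>H \<in> G"
  using s_H_mem_pstab pstab_subset by blast

lemma s_H_pseudoreflection:
  obtains \<rho> where "s\<^sub>H = pseudoreflection l\<^sub>H \<rho>" "s\<^sub>H = mat 1 \<or> lform l\<^sub>H \<rho> \<noteq> 0"
proof -
  obtain \<rho> where \<rho>: "s\<^sub>H = pseudoreflection l\<^sub>H \<rho>"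
    using s_H_mem_pstab by (rule pstab_imp_pseudoreflection)
  moreover have "s\<^sub>H = mat 1 \<or> lform l\<^sub>H \<rho> \<noteq> 0"
    using s_H_cases is_diag_reflection_iff[of \<rho>] \<rho> by (cases "\<rho> = 0") (auto split: if_splits)
  ultimately show ?thesis ..
qed

lemma primitive_root_of_unity_det_s_H: "primitive_root_of_unity e\<^sub>H (det s\<^sub>H)"
proof -
  obtain \<rho> where \<rho>: "s\<^sub>H = pseudoreflection l\<^sub>H \<rho>" "s\<^sub>H = mat 1 \<or> lform l\<^sub>H \<rho> \<noteq> 0"
    by (rule s_H_pseudoreflection)
  have "mpow (mat 1) k = mat 1" for k
    by (induction k) (simp_all add: mpow_Suc)
  then have "mpow s\<^sub>H k = mat 1 \<longleftrightarrow> det s\<^sub>H ^ k = 1" for k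
    using \<rho> mpow_pseudoreflection_eq_1_iff[of l\<^sub>H \<rho>] by auto
  then show ?thesis
    using s_H_has_order has_order_iff_primitive_root_of_unity by blast
qed

lemma s_H_eigenvector:
  obtains \<alpha> where "lform l\<^sub>H \<alpha> \<noteq> 0" "s\<^sub>H *v \<alpha> = det s\<^sub>H *s \<alpha>"
proof -
  obtain \<rho> where \<rho>: "s\<^sub>H = pseudoreflection l\<^sub>H \<rho>" "s\<^sub>H = mat 1 \<or> lform l\<^sub>H \<rho> \<noteq> 0"
    by (rule s_H_pseudoreflection)
  obtain u where u: "lform l\<^sub>H u = 1"
    using def_form_nonzero by (rule ex_lform_eq_1)
  show ?thesis
  proof (cases "s\<^sub>H = mat 1")
    case True
    then show ?thesis
      using that[of u] u by simp
  next
    case False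
    then show ?thesis
      using that[of \<rho>] \<rho> by (simp add: pseudoreflection_eigenvector)
  qed
qed

lemma
  assumes "psi s\<^sub>H ^ e\<^sub>H = 1"
  shows power_a_H: "inverse (det s\<^sub>H) ^ a_H G H psi = psi s\<^sub>H"
    and power_below_a_H: "b < a_H G H psi \<Longrightarrow> inverse (det s\<^sub>H) ^ b \<noteq> psi s\<^sub>H"
proof -
  have "primitive_root_of_unity e\<^sub>H (inverse (det s\<^sub>H))"
    using primitive_root_of_unity_det_s_H
    by (simp add: primitive_root_of_unity_def power_inverse)
  then have "psi s\<^sub>H \<in> (\<lambda>k. inverse (det s\<^sub>H) ^ k) ` {..<e\<^sub>H}"
    using primitive_root_of_unity_powers assms by blast
  then obtain k where "psi s\<^sub>H = inverse (det s\<^sub>H) ^ k"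
    by blast
  then have "psi s\<^sub>H = inverse (det s\<^sub>H) ^ a_H G H psi"
    unfolding a_H_def by (rule LeastI)
  then show "inverse (det s\<^sub>H) ^ a_H G H psi = psi s\<^sub>H" ..
  show "inverse (det s\<^sub>H) ^ b \<noteq> psi s\<^sub>H" if "b < a_H G H psi"
    using not_less_Least[OF that[unfolded a_H_def]] by metis
qed

lemma trans_roots_imp_transvection:
  assumes "\<beta> \<in> trans_roots G H"
  shows "pseudoreflection l\<^sub>H \<beta> \<in> G" "lform l\<^sub>H \<beta> = 0"
proof -
  obtain t where t: "t \<in> pstab G H" "is_transvection t" "\<And>v. t *v v = v + lform l\<^sub>H v *s \<beta>"
    using assms by (auto simp: trans_roots_def)
  have t_eq: "t = pseudoreflection l\<^sub>H \<beta>"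
    using t(3) by (rule pseudoreflection_eqI)
  show "pseudoreflection l\<^sub>H \<beta> \<in> G"
    using t(1) pstab_subset by (auto simp: t_eq)
  show "lform l\<^sub>H \<beta> = 0"
    using t(2) is_transvection_iff[of \<beta>] by (cases "\<beta> = 0") (simp_all add: t_eq)
qed

end

subsection \<open>Divisibility along one hyperplane\<close>

definition (in linear_character) wedge_exponent :: "('a ^ 'n) set \<Rightarrow> nat" where
  "wedge_exponent H = (if chi (s_H G H) = 1 then e_H G H * b_H G H else 0)
    + a_H G H chi * (CARD('n) - 1) + a_H G H (\<lambda>g. chi g * det g)"

locale hyperplane_character = hyperplane_stabilizer G H + linear_character G chi
  for G :: "('a::field ^ 'n ^ 'n::finite) set" and H chi
begin

abbreviation "a\<^sub>H \<equiv> a_H G H"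
abbreviation "b\<^sub>H \<equiv> b_H G H"
abbreviation "chi_det \<equiv> \<lambda>g. chi g * det g"

lemma chi_s_H_power: "chi s\<^sub>H ^ e\<^sub>H = 1"
  using s_H_has_order by (metis has_order_def mpow one s_H_mem)

lemma chi_det_s_H_power: "chi_det s\<^sub>H ^ e\<^sub>H = 1"
  using chi_s_H_power primitive_root_of_unity_det_s_H
  by (simp add: power_mult_distrib primitive_root_of_unity_def)

lemma dvd_semi_invariant_s_H:
  assumes "psi s\<^sub>H ^ e\<^sub>H = 1" "act s\<^sub>H f = pconst (psi s\<^sub>H) * f"
  shows "lin_poly l\<^sub>H ^ a\<^sub>H psi dvd f"
proof -
  obtain \<rho> where "s\<^sub>H = pseudoreflection l\<^sub>H \<rho>"
    by (rule s_H_pseudoreflection)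
  then show ?thesis
    using lin_poly_power_dvd_semi_invariant[OF def_form_nonzero _ invertible[OF s_H_mem] refl]
      power_a_H[of psi] power_below_a_H[of psi] assms by simp
qed

lemma dvd_contract_hyperplane:
  assumes "\<eta> \<in> chi_forms G chi" "lform l\<^sub>H v = 0"
  shows "lin_poly l\<^sub>H ^ a\<^sub>H chi dvd contract \<eta> v"
proof (intro dvd_semi_invariant_s_H chi_s_H_power)
  have "s\<^sub>H *v v = v"
    using s_H_mem_pstab assms(2) hyperplane_eq_kernel by (auto simp: pstab_def)
  then show "act s\<^sub>H (contract \<eta> v) = pconst (chi s\<^sub>H) * contract \<eta> v"
    using chi_forms_contract[OF assms(1) s_H_mem invertible[OF s_H_mem], of v] by simp
qed

lemma dvd_contract_eigenvector:
  assumes "\<eta> \<in> chi_forms G chi" "s\<^sub>H *v \<alpha> = det s\<^sub>H *s \<alpha>"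
  shows "lin_poly l\<^sub>H ^ a\<^sub>H chi_det dvd contract \<eta> \<alpha>"
proof (intro dvd_semi_invariant_s_H chi_det_s_H_power)
  show "act s\<^sub>H (contract \<eta> \<alpha>) = pconst (chi_det s\<^sub>H) * contract \<eta> \<alpha>"
    using chi_forms_contract[OF assms(1) s_H_mem invertible[OF s_H_mem], of \<alpha>] assms(2)
    by (simp add: contract_scale pconst.mult mult.assoc)
qed

lemma e_H_le_Suc_a_H_chi_det:
  assumes "chi s\<^sub>H = 1"
  shows "e\<^sub>H \<le> Suc (a\<^sub>H chi_det)"
proof -
  have "det s\<^sub>H \<noteq> 0"
    using invertible[OF s_H_mem] by (simp add: invertible_det_nz)
  moreover have "inverse (det s\<^sub>H) ^ a\<^sub>H chi_det = det s\<^sub>H"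
    using power_a_H[of chi_det, OF chi_det_s_H_power] assms by simp
  ultimately have "det s\<^sub>H ^ Suc (a\<^sub>H chi_det) = 1"
    by (simp add: field_simps)
  then show ?thesis
    using primitive_root_of_unity_det_s_H unfolding primitive_root_of_unity_def
    by (metis dvd_imp_le zero_less_Suc)
qed

lemma dvd_contract_trans_root:
  assumes \<eta>: "\<eta> \<in> chi_forms G chi" and \<beta>: "\<beta> \<in> trans_roots G H" and "chi s\<^sub>H = 1"
  shows "lin_poly l\<^sub>H ^ e\<^sub>H dvd contract \<eta> \<beta>"
proof -
  let ?t = "pseudoreflection l\<^sub>H \<beta>" and ?a = "a\<^sub>H chi_det"
  have t: "?t \<in> G" "lform l\<^sub>H \<beta> = 0" "invertible ?t"
    using trans_roots_imp_transvection[OF \<beta>] by (simp_all add: invertible)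
  obtain \<alpha> where \<alpha>: "lform l\<^sub>H \<alpha> \<noteq> 0" "s\<^sub>H *v \<alpha> = det s\<^sub>H *s \<alpha>"
    by (rule s_H_eigenvector)
  obtain h where h: "contract \<eta> \<alpha> = lin_poly l\<^sub>H ^ ?a * h"
    using dvd_contract_eigenvector[OF \<eta> \<alpha>(2)] ..
  have "act ?t (contract \<eta> \<alpha>) = contract \<eta> \<alpha> + pconst (lform l\<^sub>H \<alpha>) * contract \<eta> \<beta>"
    using chi_forms_contract[OF \<eta> t(1,3), of \<alpha>] transvection_eq_1[OF t(1,2) def_form_nonzero]
    by (simp add: pseudoreflection_mult_vec contract_add contract_scale)
  moreover have "act ?t (lin_poly l\<^sub>H) = lin_poly l\<^sub>H"
    using act_pseudoreflection_lin_poly[OF def_form_nonzero t(3)] t(2)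
    by (simp add: det_pseudoreflection)
  then have "act ?t (contract \<eta> \<alpha>) = lin_poly l\<^sub>H ^ ?a * act ?t h"
    by (simp add: h act.mult act.power)
  ultimately have "pconst (lform l\<^sub>H \<alpha>) * contract \<eta> \<beta> = lin_poly l\<^sub>H ^ ?a * (act ?t h - h)"
    by (simp add: h right_diff_distrib eq_diff_eq add.commute)
  moreover have "lin_poly l\<^sub>H ^ Suc ?a dvd lin_poly l\<^sub>H ^ ?a * (act ?t h - h)"
    unfolding power_Suc2
    by (intro mult_dvd_mono dvd_refl dvd_act_pseudoreflection_diff[OF def_form_nonzero t(3)])
  ultimately have "lin_poly l\<^sub>H ^ Suc ?a dvd contract \<eta> \<beta>"
    by (metis \<alpha>(1) dvd_pconst_mult_iff)
  then show ?thesis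
    using e_H_le_Suc_a_H_chi_det[OF assms(3)] by (meson dvd_trans le_imp_power_dvd)
qed

definition contract_exponent :: "'a ^ 'n \<Rightarrow> ('a ^ 'n) set \<Rightarrow> 'a ^ 'n \<Rightarrow> nat" where
  "contract_exponent \<alpha> B v =
    (if v = \<alpha> then a\<^sub>H chi_det else if chi s\<^sub>H = 1 \<and> v \<in> B then e\<^sub>H else a\<^sub>H chi)"

lemma sum_contract_exponent:
  assumes "finite C" "card C = CARD('n) - 1" "\<alpha> \<notin> C" "B \<subseteq> C" "card B = b\<^sub>H"
  shows "(\<Sum>v\<in>insert \<alpha> C. contract_exponent \<alpha> B v) = wedge_exponent H"
proof -
  have "(\<Sum>v\<in>C. contract_exponent \<alpha> B v) = (\<Sum>v\<in>C. if chi s\<^sub>H = 1 \<and> v \<in> B then e\<^sub>H else a\<^sub>H chi)"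
    using assms(3) by (intro sum.cong) (auto simp: contract_exponent_def)
  also have "\<dots> = (if chi s\<^sub>H = 1 then e\<^sub>H * b\<^sub>H else 0) + a\<^sub>H chi * (CARD('n) - 1)"
  proof (cases "chi s\<^sub>H = 1")
    case True
    then have "a\<^sub>H chi = 0"
      by (simp add: a_H_def)
    moreover have "C \<inter> {v. v \<in> B} = B"
      using assms(4) by blast
    ultimately show ?thesis
      using True assms(1,5) by (simp add: sum.If_cases)
  qed (simp add: assms(2))
  finally show ?thesis
    using assms(1,3) by (simp add: wedge_exponent_def contract_exponent_def)
qed

lemma lin_poly_power_dvd_top_wedge:
  fixes \<eta> :: "'n \<Rightarrow> ('a, 'n) form1"
  assumes \<eta>: "\<And>i. \<eta> i \<in> chi_forms G chi"
  shows "lin_poly l\<^sub>H ^ wedge_exponent H dvd top_wedge \<eta>"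
proof -
  obtain \<alpha> where \<alpha>: "lform l\<^sub>H \<alpha> \<noteq> 0" "s\<^sub>H *v \<alpha> = det s\<^sub>H *s \<alpha>"
    by (rule s_H_eigenvector)
  obtain B where B: "B \<subseteq> trans_roots G H" "vec.independent B" "card B = b\<^sub>H"
    unfolding b_H_def by (rule vec.basis_exists)
  have "B \<subseteq> {v. lform l\<^sub>H v = 0}"
    using B(1) trans_roots_imp_transvection(2) by blast
  then obtain C where C: "B \<subseteq> C" "C \<subseteq> {v. lform l\<^sub>H v = 0}"
      and basis: "vec.independent (insert \<alpha> C)" "vec.span (insert \<alpha> C) = UNIV"
    using hyperplane_adapted_basis[OF B(2) _ \<alpha>(1)] by blast
  have fin: "finite C" and \<alpha>_notin: "\<alpha> \<notin> C"
    using vec.finiteI_independent[OF basis(1)] C(2) \<alpha>(1) by auto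
  moreover have "card (insert \<alpha> C) = CARD('n)"
    using basis by (rule card_basis)
  ultimately have card_C: "card C = CARD('n) - 1"
    by simp
  have "lin_poly l\<^sub>H ^ contract_exponent \<alpha> B v dvd contract (\<eta> i) v" if "v \<in> insert \<alpha> C" for i v
    using that C(2) B(1) dvd_contract_eigenvector[OF \<eta> \<alpha>(2)] dvd_contract_hyperplane[OF \<eta>]
      dvd_contract_trans_root[OF \<eta>]
    by (auto simp: contract_exponent_def)
  then have "lin_poly l\<^sub>H ^ (\<Sum>v\<in>insert \<alpha> C. contract_exponent \<alpha> B v) dvd top_wedge \<eta>"
    by (rule power_dvd_top_wedge_of_basis[OF basis])
  then show ?thesis
    by (simp only: sum_contract_exponent[OF fin card_C \<alpha>_notin C(1) B(3)])
qed

end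

subsection \<open>The divisor of the wedge products\<close>

lemma (in finite_matrix_group) finite_refl_hyperplanes: "finite (refl_hyperplanes G)"
proof -
  have "refl_hyperplanes G = fixspace ` {g \<in> G. is_reflection g}"
    by (auto simp: refl_hyperplanes_def)
  then show ?thesis
    using finite by simp
qed

context linear_character
begin

definition wedge_divisor :: "('a, 'n) mpoly" where
  "wedge_divisor = Q_tilde G chi * Q_char G chi ^ (CARD('n) - 1) * Q_char G (\<lambda>g. chi g * det g)"

lemma wedge_divisor_eq_prod:
  "wedge_divisor = (\<Prod>H\<in>refl_hyperplanes G. lin_poly (def_form H) ^ wedge_exponent H)"
proof -
  have "Q_tilde G chi = (\<Prod>H\<in>refl_hyperplanes G.
      lin_poly (def_form H) ^ (if chi (s_H G H) = 1 then e_H G H * b_H G H else 0))"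
    unfolding Q_tilde_def prod.inter_filter[OF finite_refl_hyperplanes] by (intro prod.cong) auto
  moreover have "Q_char G chi ^ (CARD('n) - 1)
      = (\<Prod>H\<in>refl_hyperplanes G. lin_poly (def_form H) ^ (a_H G H chi * (CARD('n) - 1)))"
    unfolding Q_char_def prod_power_distrib power_mult ..
  ultimately show ?thesis
    by (simp add: wedge_divisor_def wedge_exponent_def Q_char_def power_add prod.distrib)
qed

lemma hyperplane_characterI:
  assumes "H \<in> refl_hyperplanes G"
  shows "hyperplane_character G H chi"
proof
  show "is_hyperplane H"
    using assms by (auto simp: refl_hyperplanes_def is_reflection_def)
qed

lemma hyperplane_stabilizerI:
  assumes "H \<in> refl_hyperplanes G"
  shows "hyperplane_stabilizer G H"
  using hyperplane_characterI[OF assms] by (rule hyperplane_character.axioms)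

lemma wedge_divisor_nonzero: "wedge_divisor \<noteq> 0"
  using hyperplane_stabilizer.def_form_nonzero[OF hyperplane_stabilizerI]
  by (auto simp: wedge_divisor_eq_prod mpoly_prod_eq_0_iff finite_refl_hyperplanes)

lemma wedge_divisor_dvd_top_wedge:
  assumes "\<And>i. \<eta> i \<in> chi_forms G chi"
  shows "wedge_divisor dvd top_wedge \<eta>"
  unfolding wedge_divisor_eq_prod
proof (rule prod_prime_elem_power_dvd[OF finite_refl_hyperplanes])
  note def_form = hyperplane_stabilizer.def_form_nonzero[OF hyperplane_stabilizerI]
    hyperplane_stabilizer.hyperplane_eq_kernel[OF hyperplane_stabilizerI]
  fix H assume H: "H \<in> refl_hyperplanes G"
  show "prime_elem (lin_poly (def_form H))"
    using def_form(1)[OF H] by (rule prime_elem_lin_poly)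
  show "x = y" if "lin_poly (def_form H) * x = lin_poly (def_form H) * y" for x y
    using that def_form(1)[OF H] by (simp add: mpoly_mult_cancel_left)
  show "lin_poly (def_form H) ^ wedge_exponent H dvd top_wedge \<eta>"
    using hyperplane_characterI[OF H] assms
    by (rule hyperplane_character.lin_poly_power_dvd_top_wedge)
  show "H = H'" if "H' \<in> refl_hyperplanes G" "lin_poly (def_form H) dvd lin_poly (def_form H')" for H'
    using lin_poly_dvd_lin_poly_imp_kernel_eq[OF def_form(1) def_form(1) that(2)] def_form(2) H that(1)
    by metis
qed

subsection \<open>A basis criterion\<close>

lemma quotient_of_wedges_invariant:
  fixes \<theta> \<theta>' :: "'n \<Rightarrow> ('a, 'n) form1"
  assumes "\<And>i. \<theta> i \<in> chi_forms G chi" "\<And>i. \<theta>' i \<in> chi_forms G chi"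
    and "top_wedge \<theta> \<noteq> 0" "top_wedge \<theta>' = top_wedge \<theta> * f"
  shows "f \<in> invariants G"
  unfolding invariants_def
proof (intro CollectI ballI)
  fix g assume g: "g \<in> G"
  let ?c = "pconst (chi g ^ CARD('n)) :: ('a, 'n) mpoly" and ?d = "pconst (det (matrix_inv g))"
  have "?c * top_wedge \<theta> = act g (top_wedge \<theta>) * ?d"
    using assms(1) g by (rule top_wedge_chi_forms[symmetric])
  then have "?c * top_wedge \<theta> * act g f = act g (top_wedge \<theta>') * ?d"
    by (simp add: assms(4) act.mult mult_ac)
  also have "\<dots> = ?c * top_wedge \<theta>'"
    using assms(2) g by (rule top_wedge_chi_forms)
  also have "\<dots> = ?c * top_wedge \<theta> * f"
    by (simp add: assms(4) mult.assoc)
  finally show "act g f = f"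
    using assms(3) nonzero[OF g] by (simp add: mpoly_mult_cancel_left)
qed

lemma chi_forms_basis_of_wedge_dvd:
  fixes \<theta> :: "'n \<Rightarrow> ('a, 'n) form1"
  assumes \<theta>: "\<And>i. \<theta> i \<in> chi_forms G chi" and "top_wedge \<theta> \<noteq> 0"
    and dvd: "\<And>\<theta>' :: 'n \<Rightarrow> ('a, 'n) form1. (\<And>i. \<theta>' i \<in> chi_forms G chi)
      \<Longrightarrow> top_wedge \<theta> dvd top_wedge \<theta>'"
    and \<eta>: "\<eta> \<in> chi_forms G chi"
  shows "\<exists>!f. (\<forall>i. f i \<in> invariants G) \<and> \<eta> = (\<lambda>j. \<Sum>i\<in>UNIV. f i * \<theta> i j)"
proof -
  have replaced: "(\<theta>(k := \<eta>)) i \<in> chi_forms G chi" for k i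
    using \<theta> \<eta> by simp
  then have "\<exists>f. top_wedge (\<theta>(k := \<eta>)) = top_wedge \<theta> * f" for k
    using dvd[of "\<theta>(k := \<eta>)"] by (simp add: dvd_def)
  then obtain f where f: "\<And>k. top_wedge (\<theta>(k := \<eta>)) = top_wedge \<theta> * f k"
    by metis
  show ?thesis
  proof (intro ex1I[of _ f] conjI allI ext)
    show "f k \<in> invariants G" for k
      using \<theta> replaced assms(2) f by (rule quotient_of_wedges_invariant)
    show "\<eta> j = (\<Sum>k\<in>UNIV. f k * \<theta> k j)" for j
      using cramer_form[of \<theta> \<eta> j] assms(2)
      by (simp add: f mult.assoc mpoly_mult_cancel_left flip: sum_distrib_left)
  next
    fix h k assume "(\<forall>i. h i \<in> invariants G) \<and> \<eta> = (\<lambda>j. \<Sum>i\<in>UNIV. h i * \<theta> i j)"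
    then have "top_wedge \<theta> * h k = top_wedge \<theta> * f k"
      using f[of k] cramer_form_coeff[of \<theta> k h] by simp
    then show "h k = f k"
      using assms(2) by (simp add: mpoly_mult_cancel_left)
  qed
qed

end

theorem theorem7p3:
  fixes G :: "('a::field ^ 'n ^ 'n::finite) set"
    and chi :: "'a ^ 'n ^ 'n \<Rightarrow> 'a"
    and \<omega> :: "'n \<Rightarrow> ('a, 'n) form1"
    and c :: 'a
  assumes "(2::'a) \<noteq> 0"
    and "reflection_group G"
    and "lin_char G chi"
    and "\<forall>i. \<omega> i \<in> chi_forms G chi"
    and "c \<noteq> 0"
    and "top_wedge \<omega> = pconst c * Q_tilde G chi * Q_char G chi ^ (CARD('n) - 1)
                        * Q_char G (\<lambda>g. chi g * det g)"
  shows "\<forall>\<eta>\<in>chi_forms G chi. \<exists>!f. (\<forall>i. f i \<in> invariants G)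
                                 \<and> \<eta> = (\<lambda>j. \<Sum>i\<in>UNIV. f i * \<omega> i j)"
proof
  interpret linear_character G chi
    using assms(2,3) by unfold_locales (simp_all add: reflection_group_def)
  have wedge: "top_wedge \<omega> = pconst c * wedge_divisor"
    using assms(6) by (simp only: wedge_divisor_def mult.assoc)
  have "top_wedge \<omega> \<noteq> 0"
    using assms(5) by (simp add: wedge wedge_divisor_nonzero)
  moreover have "top_wedge \<omega> dvd top_wedge \<theta>"
    if "\<And>i. \<theta> i \<in> chi_forms G chi" for \<theta> :: "'n \<Rightarrow> ('a, 'n) form1"
    using wedge_divisor_dvd_top_wedge[OF that] by (simp add: wedge pconst_mult_dvd_iff assms(5))
  moreover fix \<eta> assume "\<eta> \<in> chi_forms G chi"
  ultimately show "\<exists>!f. (\<forall>i. f i \<in> invariants G) \<and> \<eta> = (\<lambda>j. \<Sum>i\<in>UNIV. f i * \<omega> i j)"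
    using assms(4) by (intro chi_forms_basis_of_wedge_dvd) blast+
qed

end
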